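(* Let $p\geq 5$ be a prime, let $\lambda$ be a partition of a positive integer, and assume that the corresponding abelian $p$-group $G_{\lambda}$ is noncyclic. Then $$\mathrm{N}(\mathrm{P}(G_{\lambda}))\equiv 1 \pmod{p^{3}}.$$
   Context: For a finite group $G$, take independent commuting variables $x_g$ ($g\in G$) and let $M(G):=(x_{gh^{-1}})_{g,h\in G}$ be the group matrix. The group permanent is $\mathrm{P}(G):=\mathrm{perm}(M(G))=\sum_{\sigma}\prod_{g\in G}x_{g\sigma(g)^{-1}}\in\mathbb{Z}[x_g : g\in G]$, where $\sigma$ runs over all permutations of the set $G$. For a polynomial $f$, $\mathrm{N}(f)$ denotes the number of distinct monomials with nonzero coefficient in $f$. For a partition $\lambda=(k_1,\ldots,k_r)$, $k_1\ge\cdots\ge k_r\ge 1$, of a positive integer, the associated abelian $p$-group is $G_{\lambda}:=\mathrm{C}_{p^{k_1}}\times\mathrm{C}_{p^{k_2}}\times\cdots\times\mathrm{C}_{p^{k_r}}$, where $\mathrm{C}_n$ is the cyclic group of order $n$. *)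

theory Defs
  imports
    "HOL-Library.Poly_Mapping"
    "HOL-Algebra.Product_Groups"
    "HOL-Combinatorics.Permutations"
    "HOL-Number_Theory.Cong"
begin

text \<open>
  Polynomials over \<open>\<int>\<close> in commuting indeterminates indexed by a type: finitely supported
  maps from monomials (finitely supported exponent functions) to coefficients. The ring structure
  is the convolution product provided by \<^theory>\<open>HOL-Library.Poly_Mapping\<close>.
\<close>

type_synonym 'v monomial = "'v \<Rightarrow>\<^sub>0 nat"
type_synonym 'v int_mpoly = "'v monomial \<Rightarrow>\<^sub>0 int"

definition indet :: "'v \<Rightarrow> 'v int_mpoly" where
  "indet v = Poly_Mapping.single (Poly_Mapping.single v 1) 1"

definition num_monomials :: "'v int_mpoly \<Rightarrow> nat" where
  "num_monomials f = card (Poly_Mapping.keys f)"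

definition permanent :: "'i set \<Rightarrow> ('i \<Rightarrow> 'i \<Rightarrow> 'r::comm_ring_1) \<Rightarrow> 'r" where
  "permanent I M = (\<Sum>\<sigma> | \<sigma> permutes I. \<Prod>i\<in>I. M i (\<sigma> i))"

text \<open>
  The indeterminates are indexed by the whole type, but for \<open>g\<close> and \<open>h\<close> in the carrier only those
  indexed by elements of the carrier occur as entries.
\<close>

definition group_matrix :: "('g, 'b) monoid_scheme \<Rightarrow> 'g \<Rightarrow> 'g \<Rightarrow> 'g int_mpoly" where
  "group_matrix G g h = indet (g \<otimes>\<^bsub>G\<^esub> inv\<^bsub>G\<^esub> h)"

definition group_permanent :: "('g, 'b) monoid_scheme \<Rightarrow> 'g int_mpoly" where
  "group_permanent G = permanent (carrier G) (group_matrix G)"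

definition is_partition :: "nat \<Rightarrow> nat list \<Rightarrow> bool" where
  "is_partition n ks \<longleftrightarrow> sorted_wrt (\<ge>) ks \<and> (\<forall>k\<in>set ks. k \<ge> 1) \<and> sum_list ks = n"

definition abelian_p_group :: "nat \<Rightarrow> nat list \<Rightarrow> (nat \<Rightarrow> int) monoid" where
  "abelian_p_group p ks =
     product_group {..<length ks} (\<lambda>i. integer_mod_group (p ^ (ks ! i)))"

lemma group_abelian_p_group: "group (abelian_p_group p ks)"
  by (simp add: abelian_p_group_def)

lemma finite_carrier_abelian_p_group:
  assumes "p > 0"
  shows "finite (carrier (abelian_p_group p ks))"
  using assms
  by (auto simp: abelian_p_group_def carrier_integer_mod_group intro!: finite_PiE)

end

theory Submission
  imports Defs
    Complex_Main
    "HOL-Algebra.Multiplicative_Group"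
    "HOL-Combinatorics.Cycles"
    "HOL-Computational_Algebra.Polynomial_FPS"
begin

text \<open>
  A permutation \<open>\<sigma>\<close> of \<open>G\<close> contributes to the permanent the monomial of the multiset of all
  \<open>g \<sigma>(g)\<^sup>-\<^sup>1\<close>, with coefficient one, so nothing cancels and the number of monomials is the number of
  multisets that arise in this way. For abelian \<open>G\<close> such a multiset has \<open>|G|\<close> elements and product
  one, and by a theorem of Marshall Hall (\<open>quotients_realize\<close>) these two conditions are also
  sufficient. So the task is to count the multisets of size \<open>|G|\<close> over \<open>G\<close> with product one.

  Detecting the condition on the product by the characters of \<open>G\<close>, which can be indexed by \<open>G\<close>
  itself, turns the count into \<open>|G| N = \<Sum>u. [t^|G|] \<Prod>x. 1 / (1 - \<chi>\<^sub>u(x) t)\<close>. As \<open>\<chi>\<^sub>u\<close> takes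
  every \<open>d\<close>-th root of unity as a value equally often, where \<open>d\<close> is the order of \<open>u\<close>, the product is
  \<open>(1 - t^d)^(-|G|/d)\<close>. Hence the summand of \<open>u\<close> is \<open>c(|G|/d)\<close> with \<open>c(M) = (2M - 1 choose M)\<close>
  (\<open>order_mult_card_product_one_multisets\<close>).

  Now let \<open>|G| = p^m\<close>. Summation by parts gives
  \<open>p^m N = p^m + (\<Sum>j<m. A\<^sub>j (c(p^(m-j)) - c(p^(m-j-1))))\<close>, where \<open>A\<^sub>j\<close> is the number of \<open>u\<close> with
  \<open>u^(p^j) = 1\<close>. It suffices that \<open>p^(m+3)\<close> divides every summand. A sharpening of Wolstenholme's
  theorem for \<open>p \<ge> 5\<close> (\<open>half_central_prime_power_cong\<close>) says that the difference of the
  two values of \<open>c\<close> is divisible by \<open>p^(3(m-j))\<close>. For \<open>j \<le> m - 2\<close> the trivial bound \<open>p^j dvd A\<^sub>j\<close>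
  is then enough, since \<open>j + 3(m - j) \<ge> m + 3\<close>. For \<open>j = m - 1\<close> all of \<open>p^m dvd A\<^sub>j\<close> is required, and
  this is where noncyclicity enters: \<open>G\<close> has no element of order \<open>p^m\<close>, so \<open>A\<^sub>j = p^m\<close>.
\<close>

section \<open>Multisets of quotients along a permutation\<close>

context comm_monoid
begin

definition mprod :: "'a multiset \<Rightarrow> 'a" where
  "mprod B = (\<Otimes>g\<in>set_mset B. g [^] count B g)"

lemma mprod_superset:
  assumes "finite S" "set_mset B \<subseteq> S" "S \<subseteq> carrier G"
  shows "mprod B = (\<Otimes>g\<in>S. g [^] count B g)"
  unfolding mprod_def using assms
  by (intro finprod_mono_neutral_cong_left) (auto simp: not_in_iff)

lemma mprod_empty [simp]: "mprod {#} = \<one>"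
  by (simp add: mprod_def)

lemma mprod_closed [simp]: "set_mset B \<subseteq> carrier G \<Longrightarrow> mprod B \<in> carrier G"
  unfolding mprod_def by (intro finprod_closed) auto

lemma mprod_add_mset [simp]:
  assumes "x \<in> carrier G" "set_mset B \<subseteq> carrier G"
  shows "mprod (add_mset x B) = x \<otimes> mprod B"
proof -
  let ?S = "insert x (set_mset B)"
  have S: "?S \<subseteq> carrier G" using assms by simp
  have "mprod (add_mset x B) = (\<Otimes>g\<in>?S. g [^] count (add_mset x B) g)"
    using S by (intro mprod_superset) auto
  also have "\<dots> = (\<Otimes>g\<in>?S. (if x = g then g else \<one>) \<otimes> g [^] count B g)"
    using S assms by (intro finprod_cong') (auto simp: nat_pow_Suc m_comm simp del: nat_pow_Suc intro!: m_closed)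
  also have "\<dots> = (\<Otimes>g\<in>?S. if x = g then g else \<one>) \<otimes> (\<Otimes>g\<in>?S. g [^] count B g)"
    using S by (intro finprod_multf) auto
  also have "(\<Otimes>g\<in>?S. if x = g then g else \<one>) = x"
    using S by (intro finprod_singleton) auto
  also have "(\<Otimes>g\<in>?S. g [^] count B g) = mprod B"
    using S by (intro mprod_superset[symmetric]) auto
  finally show ?thesis .
qed

lemma mprod_image_mset_set:
  assumes "finite A" "f \<in> A \<rightarrow> carrier G"
  shows "mprod (image_mset f (mset_set A)) = finprod G f A"
  using assms by (induction A rule: finite_induct) (auto simp: Pi_iff image_subset_iff)

end

definition (in group) quotients :: "('a \<Rightarrow> 'a) \<Rightarrow> 'a multiset" where
  "quotients \<sigma> = image_mset (\<lambda>g. g \<otimes> inv (\<sigma> g)) (mset_set (carrier G))"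

text \<open>
  Follow the cycle of \<open>x\<close> under \<open>\<psi>\<close> until the next step would lead to \<open>x\<close> or \<open>y\<close>. A cycle cannot
  run into itself before it closes up at \<open>x\<close>, so the part that was walked is free of repetitions,
  and it avoids \<open>y\<close> by the choice of the stopping time.
\<close>

lemma first_hit_of_cycle:
  fixes \<psi> :: "'a \<Rightarrow> 'a"
  assumes fin: "finite A" and perm: "\<psi> permutes A" and x: "x \<in> A" "y \<noteq> x"
  obtains T where "inj_on (\<lambda>t. (\<psi> ^^ t) x) {..T}" "y \<notin> (\<lambda>t. (\<psi> ^^ t) x) ` {..T}"
    "\<psi> ((\<psi> ^^ T) x) \<in> {x, y}" "(\<lambda>t. (\<psi> ^^ t) x) ` {..T} \<subseteq> A"
proof -
  have "permutation \<psi>" using fin perm permutation_permutes by blast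
  then obtain n where n: "\<psi> ^^ n = id" "n > 0"
    using permutation_is_nilpotent by blast
  define P where "P = (\<lambda>t. \<psi> ((\<psi> ^^ t) x) \<in> {x, y})"
  have "\<psi> ((\<psi> ^^ (n - 1)) x) = (\<psi> ^^ n) x" using n(2) by (cases n) auto
  then have "P (n - 1)" by (simp add: P_def n)
  define T where "T = (LEAST t. P t)"
  have PT: "P T" unfolding T_def using \<open>P (n - 1)\<close> by (rule LeastI)
  have notP: "\<not> P t" if "t < T" for t using that unfolding T_def by (rule not_less_Least)
  have inj\<psi>: "inj (\<psi> ^^ t)" for t
    using perm permutes_inj inj_fn by blast
  have step: "(\<psi> ^^ t) x \<notin> {x, y}" if "0 < t" "t \<le> T" for t
    using notP[of "t - 1"] that by (cases t) (auto simp: P_def)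
  have "inj_on (\<lambda>t. (\<psi> ^^ t) x) {..T}"
  proof (rule linorder_inj_onI')
    fix i j assume ij: "i \<in> {..T}" "j \<in> {..T}" "i < j"
    show "(\<psi> ^^ i) x \<noteq> (\<psi> ^^ j) x"
    proof
      assume "(\<psi> ^^ i) x = (\<psi> ^^ j) x"
      moreover have "(\<psi> ^^ j) x = (\<psi> ^^ i) ((\<psi> ^^ (j - i)) x)"
        using ij by (simp flip: comp_apply[of "\<psi> ^^ i" "\<psi> ^^ (j - i)"] funpow_add)
      ultimately have "x = (\<psi> ^^ (j - i)) x"
        using inj\<psi>[of i] by (simp add: inj_eq)
      moreover have "0 < j - i" "j - i \<le> T" using ij by auto
      ultimately show False using step[of "j - i"] by auto
    qed
  qed
  moreover have "y \<notin> (\<lambda>t. (\<psi> ^^ t) x) ` {..T}"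
  proof
    assume "y \<in> (\<lambda>t. (\<psi> ^^ t) x) ` {..T}"
    then obtain t where "t \<le> T" "y = (\<psi> ^^ t) x" by auto
    then show False using step[of t] x(2) by (cases t) auto
  qed
  moreover have "(\<psi> ^^ t) x \<in> A" for t
    by (induction t) (use x perm in \<open>auto simp: permutes_in_image\<close>)
  ultimately show thesis using PT that unfolding P_def by blast
qed

text \<open>
  The step of Hall's argument: two quotients may be traded for any two elements with the same
  product. Let \<open>K = x y b\<^sup>-\<^sup>1\<close>. Sending \<open>x\<close> to \<open>K y\<^sup>-\<^sup>1\<close> produces the quotient \<open>b\<close>, but that image was
  already taken by some \<open>w\<^sub>1\<close>. Moving \<open>y\<close> to \<open>K w\<^sub>1\<^sup>-\<^sup>1\<close> reproduces the quotient that \<open>w\<^sub>1\<close> has lost,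
  because \<open>w\<^sub>1 (K y\<^sup>-\<^sup>1)\<^sup>-\<^sup>1 = y (K w\<^sub>1\<^sup>-\<^sup>1)\<^sup>-\<^sup>1\<close>; this image was taken by some \<open>w\<^sub>2\<close>, and so on. The
  elements displaced one after the other are the iterates on \<open>y\<close> of the permutation
  \<open>\<psi>(a) = \<sigma>\<^sup>-\<^sup>1(K a\<^sup>-\<^sup>1)\<close>, so the chain stops without repetition at an image that \<open>x\<close> or \<open>y\<close> had
  given up. The last displaced element gets the one image that is left, and comparing the
  products of all quotients shows that its quotient is \<open>c\<close>.
\<close>

lemma (in comm_group) quotients_exchange:
  assumes fin: "finite (carrier G)" and \<sigma>: "\<sigma> permutes carrier G"
    and x: "x \<in> carrier G" "y \<in> carrier G" "x \<noteq> y"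
    and b: "b \<in> carrier G" "c \<in> carrier G"
    and bc: "b \<otimes> c = (x \<otimes> inv (\<sigma> x)) \<otimes> (y \<otimes> inv (\<sigma> y))"
  shows "\<exists>\<tau>. \<tau> permutes carrier G \<and>
    quotients \<tau> + {#x \<otimes> inv (\<sigma> x), y \<otimes> inv (\<sigma> y)#} = quotients \<sigma> + {#b, c#}"
proof -
  define K where "K = x \<otimes> y \<otimes> inv b"
  have K: "K \<in> carrier G" using x b by (simp add: K_def)
  have \<sigma>c: "\<sigma> a \<in> carrier G \<longleftrightarrow> a \<in> carrier G" for a using \<sigma> by (simp add: permutes_in_image)
  define \<kappa> where "\<kappa> = (\<lambda>a. if a \<in> carrier G then K \<otimes> inv a else a)"
  have \<kappa>: "\<kappa> permutes carrier G"
  proof (rule bij_imp_permutes)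
    have "K \<otimes> inv (K \<otimes> inv a) = a" if "a \<in> carrier G" for a
      using that K by (simp add: inv_mult_group m_comm[of a "inv K"]) (simp add: m_assoc[symmetric])
    then show "bij_betw \<kappa> (carrier G) (carrier G)"
      using K by (intro bij_betw_byWitness[where f' = \<kappa>]) (auto simp: \<kappa>_def)
  qed (simp add: \<kappa>_def)
  define \<psi> where "\<psi> = inv_into UNIV \<sigma> \<circ> \<kappa>"
  have \<psi>: "\<psi> permutes carrier G"
    unfolding \<psi>_def using \<kappa> permutes_inv[OF \<sigma>] by (rule permutes_compose)
  have \<sigma>\<psi>: "\<sigma> (\<psi> a) = \<kappa> a" for a
    using \<sigma> by (simp add: \<psi>_def permutes_inverses)
  obtain T where inj: "inj_on (\<lambda>t. (\<psi> ^^ t) y) {..T}"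
    and xW: "x \<notin> (\<lambda>t. (\<psi> ^^ t) y) ` {..T}"
    and last: "\<psi> ((\<psi> ^^ T) y) \<in> {y, x}"
    and sub: "(\<lambda>t. (\<psi> ^^ t) y) ` {..T} \<subseteq> carrier G"
    using first_hit_of_cycle[OF fin \<psi> x(2) x(3)] by blast
  define w where "w = (\<lambda>t. (\<psi> ^^ t) y)"
  note inj = inj[folded w_def] and xW = xW[folded w_def] and sub = sub[folded w_def]
  have last: "\<psi> (w T) \<in> {x, y}" using last by (auto simp: w_def)
  have w0: "w 0 = y" and wS: "\<psi> (w t) = w (Suc t)" for t by (simp_all add: w_def)
  have wc: "w t \<in> carrier G" if "t \<le> T" for t using sub that by auto
  \<comment> \<open>The image that is still free at the end of the chain is \<open>\<sigma> z\<close>.\<close>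
  define z where "z = (if \<psi> (w T) = x then y else x)"
  have z: "{\<psi> (w T), z} = {x, y}" "z \<in> carrier G" using last x by (auto simp: z_def)
  have z2: "\<sigma> z \<otimes> \<sigma> (\<psi> (w T)) = \<sigma> x \<otimes> \<sigma> y"
    using last x by (auto simp: z_def m_comm \<sigma>c)
  define \<tau> where "\<tau> = (\<lambda>a. if a = x then \<kappa> y else if a \<in> w ` {..<T} then \<kappa> (\<psi> a)
     else if a = w T then \<sigma> z else \<sigma> a)"
  define P where "P = insert x (w ` {..T})"
  have Pc: "P \<subseteq> carrier G" using sub x by (auto simp: P_def)
  have dist: "w T \<notin> w ` {..<T}" "x \<notin> w ` {..<T}" "w T \<noteq> x"
  proof -
    show "w T \<notin> w ` {..<T}" using inj by (auto simp: inj_on_def) (metis atMost_iff less_imp_le nat_less_le order_refl)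
  qed (use xW in auto)
  have \<tau>x: "\<tau> x = \<kappa> (w 0)" by (simp add: \<tau>_def w0)
  have \<tau>w: "\<tau> (w t) = \<kappa> (w (Suc t))" if "t < T" for t
  proof -
    have "w t \<in> w ` {..<T}" using that by simp
    moreover from this have "w t \<noteq> x" using dist(2) by metis
    ultimately show ?thesis by (simp add: \<tau>_def wS)
  qed
  have \<tau>T: "\<tau> (w T) = \<sigma> z" using dist by (simp add: \<tau>_def)
  have \<tau>o: "\<tau> a = \<sigma> a" if "a \<notin> P" for a using that by (auto simp: \<tau>_def P_def)
  have atMost: "{..T} = insert T {..<T}" "{..T} = insert 0 (Suc ` {..<T})"
    by (auto simp flip: lessThan_Suc_atMost lessThan_Suc_eq_insert_0)
  \<comment> \<open>On the chain \<open>\<tau>\<close> only redistributes the images of \<open>\<sigma>\<close>, hence it is a permutation.\<close>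
  have imP: "\<tau> ` P = \<sigma> ` P"
  proof -
    have "\<tau> ` P = {\<kappa> (w 0), \<sigma> z} \<union> (\<lambda>t. \<kappa> (w (Suc t))) ` {..<T}"
    proof -
      have "\<tau> ` w ` {..<T} = (\<lambda>t. \<kappa> (w (Suc t))) ` {..<T}"
        unfolding image_image by (intro image_cong) (auto simp: \<tau>w)
      then show ?thesis unfolding P_def atMost(1) by (simp add: \<tau>x \<tau>T insert_commute)
    qed
    also have "\<dots> = {\<sigma> z} \<union> (\<lambda>t. \<kappa> (w t)) ` {..T}"
      unfolding atMost(2) by (simp add: image_image insert_commute)
    also have "\<dots> = \<sigma> ` ({z} \<union> (\<lambda>t. \<psi> (w t)) ` {..T})" by (simp add: \<sigma>\<psi> image_image)
    also have "{z} \<union> (\<lambda>t. \<psi> (w t)) ` {..T} = {\<psi> (w T), z} \<union> (\<lambda>t. w (Suc t)) ` {..<T}"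
      unfolding atMost(1) by (simp add: wS insert_commute)
    also have "\<dots> = {x, w 0} \<union> (\<lambda>t. w (Suc t)) ` {..<T}" unfolding z w0 ..
    also have "\<dots> = P" unfolding P_def atMost(2) by (simp add: image_image)
    finally show ?thesis .
  qed
  have \<tau>: "\<tau> permutes carrier G"
  proof (rule bij_imp_permutes)
    have "\<tau> ` carrier G = \<tau> ` P \<union> \<tau> ` (carrier G - P)" using Pc by blast
    also have "\<tau> ` (carrier G - P) = \<sigma> ` (carrier G - P)" using \<tau>o by (intro image_cong) auto
    also have "\<tau> ` P \<union> \<sigma> ` (carrier G - P) = \<sigma> ` carrier G" unfolding imP using Pc by blast
    also have "\<dots> = carrier G" using \<sigma> by (rule permutes_image)
    finally have "\<tau> ` carrier G = carrier G" .
    then show "bij_betw \<tau> (carrier G) (carrier G)"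
      using fin by (simp add: bij_betw_def eq_card_imp_inj_on)
    show "\<tau> a = a" if "a \<notin> carrier G" for a
      using that \<tau>o[of a] Pc permutes_not_in[OF \<sigma>] by auto
  qed
  define \<delta> where "\<delta> = (\<lambda>\<rho> g. g \<otimes> inv (\<rho> g :: 'a))"
  have \<delta>\<kappa>: "u \<otimes> inv (\<kappa> v) = u \<otimes> v \<otimes> inv K" if "u \<in> carrier G" "v \<in> carrier G" for u v
    using that K by (simp add: \<kappa>_def inv_mult_group m_assoc)
  have \<delta>x: "\<delta> \<tau> x = b"
  proof -
    have "\<delta> \<tau> x = x \<otimes> y \<otimes> inv K" using \<delta>\<kappa>[OF x(1,2)] by (simp add: \<delta>_def \<tau>x w0)
    also have "x \<otimes> y = K \<otimes> b" using x b by (simp add: K_def m_assoc)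
    also have "K \<otimes> b \<otimes> inv K = b" using K b by (simp add: m_comm[of K b] m_assoc)
    finally show ?thesis .
  qed
  \<comment> \<open>The quotients move back along the chain by one place: both sides are
    \<open>w\<^sub>t w\<^sub>t\<^sub>+\<^sub>1 K\<^sup>-\<^sup>1\<close>.\<close>
  have \<delta>w: "\<delta> \<tau> (w t) = \<delta> \<sigma> (w (Suc t))" if "t < T" for t
  proof -
    have "\<delta> \<tau> (w t) = w t \<otimes> w (Suc t) \<otimes> inv K"
      using \<delta>\<kappa>[of "w t" "w (Suc t)"] wc that by (simp add: \<delta>_def \<tau>w)
    moreover have "\<sigma> (w (Suc t)) = \<kappa> (w t)" by (simp add: \<sigma>\<psi> flip: wS)
    then have "\<delta> \<sigma> (w (Suc t)) = w (Suc t) \<otimes> w t \<otimes> inv K"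
      using \<delta>\<kappa>[of "w (Suc t)" "w t"] wc that by (simp add: \<delta>_def)
    ultimately show ?thesis using wc that by (simp add: m_comm)
  qed
  have \<delta>T: "\<delta> \<tau> (w T) = c"
  proof -
    define W S s r where defs: "W = w T" "S = \<sigma> z" "s = \<sigma> x" "r = \<sigma> y"
    have cl: "W \<in> carrier G" "S \<in> carrier G" "s \<in> carrier G" "r \<in> carrier G"
      using wc x z by (auto simp: defs \<sigma>c)
    have SW: "S \<otimes> (K \<otimes> inv W) = s \<otimes> r"
      using z2 cl(1) by (simp add: \<sigma>\<psi> \<kappa>_def defs)
    have "W \<otimes> inv S \<otimes> (s \<otimes> r) = W \<otimes> (inv S \<otimes> S \<otimes> (K \<otimes> inv W))"
      unfolding SW[symmetric] using cl K by (simp only: m_assoc m_closed inv_closed)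
    also have "\<dots> = K" using cl K by (simp add: m_comm[of K "inv W"]) (simp add: m_assoc[symmetric])
    finally have 1: "W \<otimes> inv S \<otimes> (s \<otimes> r) = K" .
    have swap: "(p \<otimes> q) \<otimes> (s \<otimes> r) = (p \<otimes> s) \<otimes> (q \<otimes> r)"
      if "p \<in> carrier G" "q \<in> carrier G" for p q
      using cl that by (simp add: m_ac)
    have "b \<otimes> (c \<otimes> (s \<otimes> r)) = (b \<otimes> c) \<otimes> (s \<otimes> r)"
      using cl b by (simp add: m_assoc)
    also have "\<dots> = (x \<otimes> inv s \<otimes> s) \<otimes> (y \<otimes> inv r \<otimes> r)"
      unfolding bc defs(3,4)[symmetric] using cl x by (intro swap) auto
    also have "\<dots> = x \<otimes> y" using cl x by (simp add: m_assoc)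
    also have "\<dots> = K \<otimes> b" using x b by (simp add: K_def m_assoc)
    also have "\<dots> = b \<otimes> K" using K b by (simp add: m_comm)
    finally have "c \<otimes> (s \<otimes> r) = K" using cl b K by simp
    with 1 have "W \<otimes> inv S \<otimes> (s \<otimes> r) = c \<otimes> (s \<otimes> r)" by simp
    then have "W \<otimes> inv S = c" using cl b by simp
    then show ?thesis by (simp add: \<delta>_def \<tau>T defs)
  qed
  have split: "image_mset (\<delta> \<rho>) (mset_set (carrier G)) =
      image_mset (\<delta> \<rho>) (mset_set (carrier G - P)) + image_mset (\<delta> \<rho>) (mset_set P)" for \<rho>
  proof -
    have "mset_set (carrier G) = mset_set ((carrier G - P) \<union> P)" using Pc by (simp add: Un_absorb2)
    also have "\<dots> = mset_set (carrier G - P) + mset_set P"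
      using fin Pc by (intro mset_set_Union) (auto intro: finite_subset)
    finally show ?thesis by simp
  qed
  have off: "image_mset (\<delta> \<tau>) (mset_set (carrier G - P)) = image_mset (\<delta> \<sigma>) (mset_set (carrier G - P))"
    using fin \<tau>o by (intro image_mset_cong) (auto simp: \<delta>_def)
  have on: "image_mset f (mset_set P) = add_mset (f x) (image_mset (\<lambda>t. f (w t)) (mset_set {..T}))" for f :: "'a \<Rightarrow> 'a"
    using inj xW by (simp add: P_def multiset.map_comp o_def flip: image_mset_mset_set)
  have "image_mset (\<delta> \<tau>) (mset_set P) = {#b, c#} + image_mset (\<lambda>t. \<delta> \<tau> (w t)) (mset_set {..<T})"
    unfolding on unfolding atMost(1) by (simp add: \<delta>x \<delta>T)
  also have "image_mset (\<lambda>t. \<delta> \<tau> (w t)) (mset_set {..<T}) = image_mset (\<lambda>t. \<delta> \<sigma> (w (Suc t))) (mset_set {..<T})"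
    by (intro image_mset_cong) (auto simp: \<delta>w)
  finally have 1: "image_mset (\<delta> \<tau>) (mset_set P) = {#b, c#} + image_mset (\<lambda>t. \<delta> \<sigma> (w (Suc t))) (mset_set {..<T})" .
  have "mset_set (Suc ` {..<T}) = image_mset Suc (mset_set {..<T})"
    by (simp add: image_mset_mset_set)
  then have 2: "image_mset (\<delta> \<sigma>) (mset_set P) = {#\<delta> \<sigma> x, \<delta> \<sigma> y#} + image_mset (\<lambda>t. \<delta> \<sigma> (w (Suc t))) (mset_set {..<T})"
    unfolding on unfolding atMost(2) by (simp add: w0 multiset.map_comp o_def)
  have "quotients \<rho> = image_mset (\<delta> \<rho>) (mset_set (carrier G))" for \<rho>
    by (simp add: quotients_def \<delta>_def)
  then have "quotients \<tau> + {#x \<otimes> inv (\<sigma> x), y \<otimes> inv (\<sigma> y)#} = quotients \<sigma> + {#b, c#}"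
    by (simp only: split off 1 2) (simp add: \<delta>_def)
  with \<tau> show ?thesis by blast
qed

text \<open>
  Hall's theorem. If all elements of \<open>B\<close> are one, the identity permutation works. Otherwise at
  least two elements \<open>b\<close> and \<open>c\<close> of \<open>B\<close> are not one, as the product is one. Replacing them by one
  and \<open>b c\<close> leaves fewer nontrivial elements, and \<open>quotients_exchange\<close> undoes the replacement.
\<close>

theorem (in comm_group) quotients_realize:
  assumes fin: "finite (carrier G)" and B: "set_mset B \<subseteq> carrier G" "size B = Coset.order G" "mprod B = \<one>"
  shows "\<exists>\<sigma>. \<sigma> permutes carrier G \<and> quotients \<sigma> = B"
  using B
proof (induction "size (filter_mset (\<lambda>b. b \<noteq> \<one>) B)" arbitrary: B rule: less_induct)
  case less
  show ?case
  proof (cases "\<forall>b\<in>#B. b = \<one>")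
    case True
    then have "B = replicate_mset (Coset.order G) \<one>"
      using less.prems(2) set_mset_subset_singletonD[of B \<one>] by auto
    moreover have "quotients id = replicate_mset (Coset.order G) \<one>"
    proof -
      have "quotients id = image_mset (\<lambda>_. \<one>) (mset_set (carrier G))"
        unfolding quotients_def using fin by (intro image_mset_cong) auto
      then show ?thesis by (simp add: image_mset_const_eq Coset.order_def)
    qed
    ultimately show ?thesis using permutes_id by blast
  next
    case False
    then obtain b B1 where b: "B = add_mset b B1" "b \<noteq> \<one>" by (metis mset_add)
    have "\<exists>c\<in>#B1. c \<noteq> \<one>"
    proof (rule ccontr)
      assume "\<not> ?thesis"
      then have "mprod B1 = \<one>"
        unfolding mprod_def by (intro finprod_one_eqI) auto
      then show False using less.prems b by auto
    qed
    then obtain c B2 where c: "B1 = add_mset c B2" "c \<noteq> \<one>" by (metis mset_add)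
    have cl: "b \<in> carrier G" "c \<in> carrier G" "set_mset B2 \<subseteq> carrier G"
      using less.prems b c by auto
    define B' where "B' = {#\<one>, b \<otimes> c#} + B2"
    have "\<exists>\<sigma>. \<sigma> permutes carrier G \<and> quotients \<sigma> = B'"
    proof (rule less.hyps)
      show "size (filter_mset (\<lambda>b. b \<noteq> \<one>) B') < size (filter_mset (\<lambda>b. b \<noteq> \<one>) B)"
        using b c by (simp add: B'_def)
      show "set_mset B' \<subseteq> carrier G" "size B' = Coset.order G"
        using cl less.prems(2) b c by (auto simp: B'_def)
      show "mprod B' = \<one>"
        using cl less.prems(3) b c by (simp add: B'_def m_assoc)
    qed
    then obtain \<sigma> where \<sigma>: "\<sigma> permutes carrier G" "quotients \<sigma> = B'" by blast
    have \<sigma>c: "\<sigma> a \<in> carrier G \<longleftrightarrow> a \<in> carrier G" for a using \<sigma> by (simp add: permutes_in_image)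
    have "\<one> \<in># quotients \<sigma>" by (simp add: \<sigma> B'_def)
    then obtain x where x: "x \<in> carrier G" "x \<otimes> inv (\<sigma> x) = \<one>"
      using fin by (auto simp: quotients_def)
    define M where "M = mset_set (carrier G - {x})"
    have M: "mset_set (carrier G) = add_mset x M"
      using fin x by (simp add: M_def mset_set.remove)
    have "image_mset (\<lambda>g. g \<otimes> inv (\<sigma> g)) M = add_mset (b \<otimes> c) B2"
      using \<sigma>(2) x by (simp add: quotients_def M B'_def)
    moreover have setM: "set_mset M = carrier G - {x}"
      unfolding M_def using fin by (intro finite_set_mset_mset_set) auto
    ultimately have "b \<otimes> c \<in># image_mset (\<lambda>g. g \<otimes> inv (\<sigma> g)) M" by simp
    then obtain y where "y \<in># M" and y_eq: "b \<otimes> c = y \<otimes> inv (\<sigma> y)" by auto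
    then have y: "y \<in> carrier G" "y \<noteq> x" "y \<otimes> inv (\<sigma> y) = b \<otimes> c"
      using setM by auto
    have "\<exists>\<tau>. \<tau> permutes carrier G \<and>
        quotients \<tau> + {#x \<otimes> inv (\<sigma> x), y \<otimes> inv (\<sigma> y)#} = quotients \<sigma> + {#b, c#}"
      by (rule quotients_exchange) (use fin \<sigma> x y cl in auto)
    then show ?thesis
      by (auto simp: x y \<sigma> B'_def b c)
  qed
qed

text \<open>
  Numerators and denominators both run through the whole group.
\<close>

lemma (in comm_group) mprod_quotients:
  assumes fin: "finite (carrier G)" and \<sigma>: "\<sigma> permutes carrier G"
  shows "mprod (quotients \<sigma>) = \<one>"
proof -
  have \<sigma>c: "\<sigma> a \<in> carrier G \<longleftrightarrow> a \<in> carrier G" for a using \<sigma> by (simp add: permutes_in_image)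
  let ?p = "\<Otimes>g\<in>carrier G. g"
  have "mprod (quotients \<sigma>) = (\<Otimes>g\<in>carrier G. g \<otimes> inv (\<sigma> g))"
    unfolding quotients_def using fin by (intro mprod_image_mset_set) (auto simp: \<sigma>c)
  also have "\<dots> = ?p \<otimes> (\<Otimes>g\<in>carrier G. inv (\<sigma> g))"
    by (intro finprod_multf) (auto simp: \<sigma>c)
  also have "(\<Otimes>g\<in>carrier G. inv (\<sigma> g)) = (\<Otimes>g\<in>\<sigma> ` carrier G. inv g)"
    by (rule finprod_reindex[symmetric]) (use \<sigma> in \<open>auto simp: \<sigma>c permutes_inj_on\<close>)
  also have "?p \<otimes> \<dots> = (\<Otimes>g\<in>carrier G. g \<otimes> inv g)"
    unfolding permutes_image[OF \<sigma>] by (intro finprod_multf[symmetric]) auto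
  also have "\<dots> = \<one>" by (intro finprod_one_eqI) auto
  finally show ?thesis .
qed

section \<open>The monomials of the group permanent\<close>

definition multiset_monomial :: "'v multiset \<Rightarrow> 'v monomial" where
  "multiset_monomial B = (\<Sum>b\<in>#B. Poly_Mapping.single b 1)"

lemma lookup_multiset_monomial: "Poly_Mapping.lookup (multiset_monomial B) v = count B v"
  by (induction B) (auto simp: multiset_monomial_def lookup_add lookup_single when_def)

lemma inj_multiset_monomial: "inj multiset_monomial"
  by (intro injI multiset_eqI) (metis lookup_multiset_monomial)

lemma prod_indet:
  "(\<Prod>i\<in>I. indet (f i)) = Poly_Mapping.single (multiset_monomial (image_mset f (mset_set I))) 1"
  by (induction I rule: infinite_finite_induct)
    (auto simp: multiset_monomial_def indet_def mult_single single_one)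

text \<open>
  Each coefficient is a sum of ones, which cannot vanish in the integers unless it is empty.
\<close>

lemma keys_sum_single_one:
  assumes "finite S"
  shows "Poly_Mapping.keys (\<Sum>s\<in>S. Poly_Mapping.single (f s) (1::int)) = f ` S"
proof -
  have "Poly_Mapping.lookup (\<Sum>s\<in>S. Poly_Mapping.single (f s) (1::int)) m = int (card {s\<in>S. m = f s})" for m
    using assms by (simp add: lookup_sum lookup_single when_def sum.If_cases Int_def)
  then show ?thesis using assms by (auto simp: in_keys_iff)
qed

definition (in comm_monoid) product_one_multisets :: "nat \<Rightarrow> 'a multiset set" where
  "product_one_multisets k = {B \<in> multisets_of_size (carrier G) k. mprod B = \<one>}"

theorem (in comm_group) num_monomials_group_permanent:
  assumes fin: "finite (carrier G)"
  shows "num_monomials (group_permanent G) = card (product_one_multisets (Coset.order G))"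
proof -
  let ?S = "{\<sigma>. \<sigma> permutes carrier G}"
  have "group_permanent G = (\<Sum>\<sigma>\<in>?S. Poly_Mapping.single (multiset_monomial (quotients \<sigma>)) 1)"
    by (simp add: group_permanent_def permanent_def group_matrix_def prod_indet quotients_def)
  then have "Poly_Mapping.keys (group_permanent G) = multiset_monomial ` quotients ` ?S"
    using fin by (simp add: keys_sum_single_one finite_permutations image_image)
  also have "quotients ` ?S = product_one_multisets (Coset.order G)"
  proof
    show "quotients ` ?S \<subseteq> product_one_multisets (Coset.order G)"
      using fin by (auto simp: product_one_multisets_def multisets_of_size_def quotients_def
          mprod_quotients[unfolded quotients_def] permutes_in_image Coset.order_def)
    show "product_one_multisets (Coset.order G) \<subseteq> quotients ` ?S"
      using quotients_realize[OF fin] by (auto simp: product_one_multisets_def multisets_of_size_def)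
  qed
  finally show ?thesis
    by (simp add: num_monomials_def card_image inj_on_subset[OF inj_multiset_monomial])
qed

section \<open>A congruence for binomial coefficients at prime powers\<close>

lemma binomial_mult_prod:
  "(q + m choose m) * (\<Prod>i=1..m. i) = (\<Prod>i=1..m. q + i)"
proof (induction m)
  case (Suc m)
  have "(\<Prod>i=1..Suc m. i) = Suc m * (\<Prod>i=1..m. i)" by (rule prod.nat_ivl_Suc') simp
  then have "(q + Suc m choose Suc m) * (\<Prod>i=1..Suc m. i) = (Suc m * (q + Suc m choose Suc m)) * (\<Prod>i=1..m. i)"
    by (simp only: mult_ac)
  also have "Suc m * (q + Suc m choose Suc m) = (q + Suc m) * (q + m choose m)"
    by (subst binomial_absorption) simp
  also have "\<dots> * (\<Prod>i=1..m. i) = (\<Prod>i=1..Suc m. q + i)"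
  proof -
    have "(\<Prod>i=1..Suc m. q + i) = (q + Suc m) * (\<Prod>i=1..m. q + i)" by (rule prod.nat_ivl_Suc') simp
    then show ?thesis using Suc by (simp only: mult.assoc)
  qed
  finally show ?case .
qed simp

text \<open>
  Half of the central binomial coefficient \<open>(2N choose N)\<close> when \<open>N > 0\<close>. It is the number of
  multisets of size \<open>N\<close> over \<open>N\<close> elements, that is, the coefficient of \<open>t^N\<close> in \<open>(1 - t)^(-N)\<close>.
\<close>

definition half_central :: "nat \<Rightarrow> nat" where
  "half_central N = (2 * N - 1) choose N"

lemma half_central_mult_prod:
  assumes "N > 0"
  shows "half_central N * (\<Prod>i\<in>{1..<N}. i) = (\<Prod>i\<in>{1..<N}. N + i)"
proof -
  have "half_central N = (N + (N - 1)) choose (N - 1)"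
    using assms binomial_symmetric[of N "2 * N - 1"] by (simp add: half_central_def mult_2)
  moreover have "{1..<N} = {1..N - 1}" using assms by auto
  ultimately show ?thesis by (simp add: binomial_mult_prod del: One_nat_def)
qed

text \<open>
  In the product formula \<open>half_central_mult_prod\<close> for \<open>p N\<close>, the factors at the multiples of \<open>p\<close>
  are \<open>p\<close> times those for \<open>N\<close>. Cancelling them leaves only factors that are coprime to \<open>p\<close>.
\<close>

lemma half_central_mult_prod_coprime:
  fixes p :: nat
  assumes p: "Factorial_Ring.prime p" and N: "N > 0"
  defines "U \<equiv> {i\<in>{1..<p * N}. coprime i p}"
  shows "half_central (p * N) * (\<Prod>i\<in>U. i) = half_central N * (\<Prod>i\<in>U. p * N + i)"
proof -
  have p0: "p > 0" using p by (simp add: prime_gt_0_nat)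
  have split: "(\<Prod>i\<in>{1..<p * N}. f i) = (\<Prod>i\<in>U. f i) * (\<Prod>j\<in>{1..<N}. f (p * j))" for f :: "nat \<Rightarrow> nat"
  proof -
    have "{1..<p * N} = U \<union> (\<lambda>j. p * j) ` {1..<N}"
    proof
      show "{1..<p * N} \<subseteq> U \<union> (\<lambda>j. p * j) ` {1..<N}"
      proof
        fix i assume i: "i \<in> {1..<p * N}"
        show "i \<in> U \<union> (\<lambda>j. p * j) ` {1..<N}"
        proof (cases "coprime i p")
          case False
          then have "p dvd i" using p by (metis coprime_commute prime_imp_coprime)
          then obtain j where "i = p * j" by blast
          then show ?thesis using i by (auto simp: image_iff)
        qed (use i in \<open>simp add: U_def\<close>)
      qed
    qed (use p0 in \<open>auto simp: U_def Suc_le_eq\<close>)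
    moreover have "U \<inter> (\<lambda>j. p * j) ` {1..<N} = {}"
      using p by (auto simp: U_def not_prime_1)
    moreover have "finite U" by (simp add: U_def)
    moreover have "inj_on (\<lambda>j. p * j) {1..<N}" using p0 by (auto intro: inj_onI)
    ultimately show ?thesis by (simp add: prod.union_disjoint prod.reindex)
  qed
  let ?F = "p ^ card {1..<N} * (\<Prod>j\<in>{1..<N}. j)"
  have "half_central (p * N) * (\<Prod>i\<in>{1..<p * N}. i) = (\<Prod>i\<in>{1..<p * N}. p * N + i)"
    using p0 N by (intro half_central_mult_prod) simp
  then have "half_central (p * N) * (\<Prod>i\<in>U. i) * ?F =
      (\<Prod>i\<in>U. p * N + i) * (\<Prod>j\<in>{1..<N}. p * (N + j))"
    unfolding split by (simp only: prod.distrib prod_constant mult.assoc distrib_left)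
  also have "(\<Prod>j\<in>{1..<N}. p * (N + j)) = half_central N * ?F"
    using half_central_mult_prod[OF N] by (simp add: prod.distrib mult_ac del: One_nat_def)
  finally have "(half_central (p * N) * (\<Prod>i\<in>U. i)) * ?F = (half_central N * (\<Prod>i\<in>U. p * N + i)) * ?F"
    by (simp only: mult_ac)
  moreover have "?F \<noteq> 0" using p0 by simp
  ultimately show ?thesis using mult_right_cancel[of ?F] by blast
qed

text \<open>
  The expansion of the product in powers of \<open>t\<close>, up to the linear term.
\<close>

lemma prod_add_const_cong:
  fixes e :: "'i \<Rightarrow> int"
  assumes "finite U"
  shows "[(\<Prod>i\<in>U. e i + t) = (\<Prod>i\<in>U. e i) + t * (\<Sum>i\<in>U. \<Prod>j\<in>U - {i}. e j)] (mod t ^ 2)"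
  using assms
proof (induction U rule: finite_induct)
  case (insert a U)
  have "(\<Sum>i\<in>U. \<Prod>j\<in>insert a U - {i}. e j) = (\<Sum>i\<in>U. e a * (\<Prod>j\<in>U - {i}. e j))"
  proof (intro sum.cong refl)
    fix i assume "i \<in> U"
    then have "insert a U - {i} = insert a (U - {i})" using insert.hyps by auto
    then show "(\<Prod>j\<in>insert a U - {i}. e j) = e a * (\<Prod>j\<in>U - {i}. e j)"
      using insert.hyps by simp
  qed
  then have S: "(\<Sum>i\<in>insert a U. \<Prod>j\<in>insert a U - {i}. e j) =
      (\<Prod>j\<in>U. e j) + e a * (\<Sum>i\<in>U. \<Prod>j\<in>U - {i}. e j)"
    using insert.hyps by (simp add: sum_distrib_left)
  have "[(e a + t) * (\<Prod>i\<in>U. e i + t) =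
      (e a + t) * ((\<Prod>i\<in>U. e i) + t * (\<Sum>i\<in>U. \<Prod>j\<in>U - {i}. e j))] (mod t ^ 2)"
    using insert.IH by (rule cong_scalar_left)
  moreover have "(e a + t) * ((\<Prod>i\<in>U. e i) + t * (\<Sum>i\<in>U. \<Prod>j\<in>U - {i}. e j)) -
      ((\<Prod>i\<in>insert a U. e i) + t * (\<Sum>i\<in>insert a U. \<Prod>j\<in>insert a U - {i}. e j)) =
      t ^ 2 * (\<Sum>i\<in>U. \<Prod>j\<in>U - {i}. e j)"
    unfolding S using insert.hyps by (simp add: algebra_simps power2_eq_square)
  then have "[(e a + t) * ((\<Prod>i\<in>U. e i) + t * (\<Sum>i\<in>U. \<Prod>j\<in>U - {i}. e j)) =
      (\<Prod>i\<in>insert a U. e i) + t * (\<Sum>i\<in>insert a U. \<Prod>j\<in>insert a U - {i}. e j)] (mod t ^ 2)"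
    by (simp add: cong_iff_dvd_diff)
  ultimately show ?case
    unfolding prod.insert[OF insert.hyps, of "\<lambda>i. e i + t"] by (rule cong_trans)
qed simp

text \<open>
  The set \<open>U\<close> represents the units modulo a power \<open>q\<close> of \<open>p\<close>. The bound \<open>p \<ge> 5\<close> makes 2 and 3 units.
\<close>

locale coprime_residues =
  fixes p q :: int and U :: "int set"
  assumes p: "Factorial_Ring.prime p" "p \<ge> 5" and q: "\<exists>k>0. q = p ^ k"
  defines "U \<equiv> {i \<in> {0<..<q}. coprime i q}"
begin

lemma q_pos: "q > 0"
  using p q by auto

lemma coprime_small: "coprime 2 q" "coprime 3 q"
proof -
  have "coprime 2 p" "coprime 3 p"
    by (rule primes_coprime; use p in simp)+
  then show "coprime 2 q" "coprime 3 q" using q by auto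
qed

lemma finU: "finite U"
  unfolding U_def by (rule finite_subset[of _ "{0<..<q}"]) auto

lemma q_gt_1: "q > 1"
proof -
  obtain k where "k > 0" "q = p ^ k" using q by blast
  then show ?thesis using p by (simp add: one_less_power)
qed

lemma bij_betw_double: "bij_betw (\<lambda>i. (2 * i) mod q) U U"
proof -
  have "(2 * i) mod q \<in> U" if "i \<in> U" for i
  proof -
    have "coprime (2 * i) q" using that coprime_small by (simp add: U_def)
    then have c: "coprime ((2 * i) mod q) q" using q_pos by (subst coprime_mod_left_iff) auto
    then have "(2 * i) mod q \<noteq> 0" using q_gt_1 by (intro notI) simp
    then show ?thesis using c q_pos pos_mod_bound[of q "2 * i"] pos_mod_sign[of q "2 * i"]
      by (simp add: U_def order_less_le)
  qed
  moreover have "inj_on (\<lambda>i. (2 * i) mod q) U"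
  proof (rule inj_onI)
    fix i j assume ij: "i \<in> U" "j \<in> U" "(2 * i) mod q = (2 * j) mod q"
    then have "[2 * i = 2 * j] (mod q)" by (simp add: cong_def)
    then have "[i = j] (mod q)" using coprime_small(1) by (simp add: cong_mult_lcancel)
    then show "i = j" using ij by (simp add: cong_def U_def)
  qed
  moreover from calculation have "(\<lambda>i. (2 * i) mod q) ` U = U"
    by (intro endo_inj_surj finU) auto
  ultimately show ?thesis by (simp add: bij_betw_def)
qed

lemma bij_betw_reflect: "bij_betw (\<lambda>i. q - i) U U"
proof (rule bij_betw_byWitness[where f' = "\<lambda>i. q - i"])
  have "coprime (q - i) q" if "coprime i q" for i
  proof (rule coprimeI)
    fix c assume "c dvd q - i" "c dvd q"
    then have "c dvd q - (q - i)" by (rule dvd_diff[rotated])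
    then have "c dvd i" by simp
    then show "is_unit c" using that \<open>c dvd q\<close> coprime_common_divisor by blast
  qed
  then show "(\<lambda>i. q - i) ` U \<subseteq> U" "(\<lambda>i. q - i) ` U \<subseteq> U" by (auto simp: U_def)
qed auto

text \<open>
  Up to the unit \<open>\<Prod>j. j (q - j)\<close>, the sum is \<open>- (\<Sum>i. 1 / i\<^sup>2)\<close> modulo \<open>q\<close>. Doubling permutes the
  units and divides every summand by 4, so 3 times the sum vanishes.
\<close>

lemma sum_cofactors_dvd:
  "q dvd (\<Sum>i\<in>U. \<Prod>j\<in>U - {i}. j * (q - j))"
proof -
  define e where "e = (\<lambda>i. i * (q - i))"
  define w where "w = (\<lambda>i. \<Prod>j\<in>U - {i}. e j)"
  define \<rho> where "\<rho> = (\<lambda>i. (2 * i) mod q)"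
  have we: "e i * w i = (\<Prod>j\<in>U. e j)" if "i \<in> U" for i
    unfolding w_def using finU that by (rule prod.remove[symmetric])
  have \<rho>: "\<rho> i \<in> U" if "i \<in> U" for i
    using that bij_betw_double by (auto simp: \<rho>_def bij_betw_def)
  have "[4 * w (\<rho> i) = w i] (mod q)" if i: "i \<in> U" for i
  proof -
    have e: "[e j = - (j * j)] (mod q)" for j
      by (simp add: e_def cong_iff_dvd_diff algebra_simps)
    have "[\<rho> i * \<rho> i = (2 * i) * (2 * i)] (mod q)"
      unfolding \<rho>_def by (intro cong_mult) (simp_all add: cong_def)
    then have "[- (\<rho> i * \<rho> i) = - ((2 * i) * (2 * i))] (mod q)"
      by (simp add: cong_minus_minus_iff)
    then have "[e (\<rho> i) = 4 * - (i * i)] (mod q)"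
      using e[of "\<rho> i"] by (auto intro: cong_trans)
    moreover have "[4 * e i = 4 * - (i * i)] (mod q)" using e by (rule cong_scalar_left)
    ultimately have "[4 * e i = e (\<rho> i)] (mod q)" by (metis cong_sym cong_trans)
    then have "[4 * e i * w (\<rho> i) = e (\<rho> i) * w (\<rho> i)] (mod q)" by (rule cong_scalar_right)
    also have "e (\<rho> i) * w (\<rho> i) = e i * w i" using we \<rho> i by metis
    finally have "[e i * (4 * w (\<rho> i)) = e i * w i] (mod q)" by (simp add: mult_ac)
    moreover have "coprime (e i) q"
      using i bij_betw_reflect by (auto simp: e_def U_def bij_betw_def)
    ultimately show ?thesis by (simp add: cong_mult_lcancel)
  qed
  then have "[(\<Sum>i\<in>U. 4 * w (\<rho> i)) = (\<Sum>i\<in>U. w i)] (mod q)" by (rule cong_sum)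
  moreover have "(\<Sum>i\<in>U. w (\<rho> i)) = (\<Sum>i\<in>U. w i)"
    unfolding \<rho>_def by (rule sum.reindex_bij_betw[OF bij_betw_double])
  ultimately have "[4 * (\<Sum>i\<in>U. w i) = (\<Sum>i\<in>U. w i)] (mod q)" by (simp flip: sum_distrib_left)
  then have "q dvd 3 * (\<Sum>i\<in>U. w i)" by (simp add: cong_iff_dvd_diff)
  then have "q dvd (\<Sum>i\<in>U. w i)"
    using coprime_small(2) by (simp add: coprime_commute coprime_dvd_mult_right_iff)
  then show ?thesis by (simp add: w_def e_def)
qed

text \<open>
  Write \<open>Q\<close> and \<open>R\<close> for the two sides. Pairing \<open>i\<close> with \<open>q - i\<close> gives
  \<open>(q + i) (q + (q - i)) = i (q - i) + 2q\<^sup>2\<close>. The product over all \<open>i\<close> is \<open>Q\<^sup>2\<close> on the left, and on the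
  right it is \<open>R\<^sup>2\<close> plus \<open>2q\<^sup>2\<close> times the sum in \<open>sum_cofactors_dvd\<close>, modulo \<open>q^4\<close>. So
  \<open>Q\<^sup>2\<close> and \<open>R\<^sup>2\<close> agree modulo \<open>q\<^sup>3\<close>, and \<open>Q + R\<close> is a unit because it is \<open>2R\<close> modulo \<open>q\<close>.
\<close>

theorem prod_shift_cong: "[(\<Prod>i\<in>U. q + i) = (\<Prod>i\<in>U. i)] (mod q ^ 3)"
proof -
  define Q R where "Q = (\<Prod>i\<in>U. q + i)" and "R = (\<Prod>i\<in>U. i)"
  let ?e = "\<lambda>i. i * (q - i)" and ?t = "2 * q ^ 2"
  have "(\<Prod>i\<in>U. ?e i + ?t) = (\<Prod>i\<in>U. (q + i) * (q + (q - i)))"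
    by (intro prod.cong refl) (simp add: algebra_simps power2_eq_square)
  also have "\<dots> = Q * (\<Prod>i\<in>U. q + (q - i))" by (simp add: prod.distrib Q_def)
  also have "(\<Prod>i\<in>U. q + (q - i)) = Q"
    unfolding Q_def by (rule prod.reindex_bij_betw[OF bij_betw_reflect])
  finally have Q: "(\<Prod>i\<in>U. ?e i + ?t) = Q * Q" .
  have "(\<Prod>i\<in>U. ?e i) = R * (\<Prod>i\<in>U. q - i)" by (simp add: prod.distrib R_def)
  also have "(\<Prod>i\<in>U. q - i) = R"
    unfolding R_def by (rule prod.reindex_bij_betw[OF bij_betw_reflect])
  finally have R: "(\<Prod>i\<in>U. ?e i) = R * R" .
  have "[Q * Q = R * R + ?t * (\<Sum>i\<in>U. \<Prod>j\<in>U - {i}. ?e j)] (mod ?t ^ 2)"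
    using prod_add_const_cong[OF finU, of ?e ?t] unfolding Q R .
  moreover have "q ^ 3 dvd ?t ^ 2"
    by (rule dvdI[of _ _ "4 * q"]) (simp add: power2_eq_square power3_eq_cube)
  ultimately have "[Q * Q = R * R + ?t * (\<Sum>i\<in>U. \<Prod>j\<in>U - {i}. ?e j)] (mod q ^ 3)"
    by (rule cong_dvd_modulus)
  moreover obtain s where "(\<Sum>i\<in>U. \<Prod>j\<in>U - {i}. ?e j) = q * s" using sum_cofactors_dvd by blast
  moreover have "[R * R + ?t * (q * s) = R * R] (mod q ^ 3)"
    by (simp add: cong_iff_dvd_diff power2_eq_square power3_eq_cube)
  ultimately have "[Q * Q = R * R] (mod q ^ 3)" by (metis cong_trans)
  then have "q ^ 3 dvd (Q - R) * (Q + R)" by (simp add: cong_iff_dvd_diff algebra_simps)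
  moreover have "coprime (Q + R) (q ^ 3)"
  proof -
    have "[Q = R] (mod q)" unfolding Q_def R_def by (intro cong_prod) (simp add: cong_def)
    then have "[Q + R = R + R] (mod q)" by (intro cong_add) auto
    moreover have "coprime R q" unfolding R_def by (intro prod_coprime_left) (simp add: U_def)
    then have "coprime (2 * R) q" using coprime_small by simp
    then have "coprime (R + R) q" by (simp only: mult_2)
    ultimately have "coprime (Q + R) q" by (meson cong_imp_coprime cong_sym)
    then show ?thesis by simp
  qed
  ultimately have "q ^ 3 dvd Q - R"
    by (simp add: coprime_commute coprime_dvd_mult_left_iff)
  then show ?thesis by (simp add: Q_def R_def cong_iff_dvd_diff)
qed

end

text \<open>
  For \<open>k = 0\<close> this is Wolstenholme's theorem \<open>(2p - 1 choose p) \<equiv> 1\<close> modulo \<open>p\<^sup>3\<close>. By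
  \<open>half_central_mult_prod_coprime\<close> the ratio of the two values is the ratio of the two products in
  \<open>prod_shift_cong\<close> for \<open>q = p^(k+1)\<close>.
\<close>

theorem half_central_prime_power_cong:
  fixes p k :: nat
  assumes p: "Factorial_Ring.prime p" "p \<ge> 5"
  shows "int p ^ (3 * Suc k) dvd int (half_central (p ^ Suc k)) - int (half_central (p ^ k))"
proof -
  define q where "q = p ^ Suc k"
  have q_eq: "q = p * p ^ k" by (simp add: q_def)
  define V where "V = {i\<in>{1..<q}. coprime i p}"
  define U' where "U' = {i \<in> {0<..<int q}. coprime i (int q)}"
  interpret coprime_residues "int p" "int q" U'
    by unfold_locales (use p in \<open>auto simp: U'_def q_def intro!: exI[of _ "Suc k"]\<close>)
  have U': "U' = int ` V"
  proof -
    have c: "coprime (int i) (int q) \<longleftrightarrow> coprime i p" for i by (auto simp: q_def)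
    have "x \<in> int ` V" if "x \<in> U'" for x
    proof -
      obtain i where "x = int i" using \<open>x \<in> U'\<close> zero_less_imp_eq_int by (auto simp: U'_def)
      moreover from this have "i \<in> V" using \<open>x \<in> U'\<close> c[of i] by (simp add: U'_def V_def)
      ultimately show ?thesis by blast
    qed
    moreover have "int ` V \<subseteq> U'" using c by (auto simp: U'_def V_def)
    ultimately show ?thesis by blast
  qed
  have R: "(\<Prod>i\<in>U'. i) = int (\<Prod>i\<in>V. i)" and Q: "(\<Prod>i\<in>U'. int q + i) = int (\<Prod>i\<in>V. q + i)"
    unfolding U' by (simp_all add: prod.reindex)
  have "int (half_central q) * (\<Prod>i\<in>U'. i) = int (half_central (p ^ k)) * (\<Prod>i\<in>U'. int q + i)"
    unfolding R Q of_nat_mult[symmetric] of_nat_eq_iff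
    using half_central_mult_prod_coprime[OF assms(1), of "p ^ k"] assms by (simp add: q_eq V_def)
  moreover have "[int (half_central (p ^ k)) * (\<Prod>i\<in>U'. int q + i) = int (half_central (p ^ k)) * (\<Prod>i\<in>U'. i)] (mod int q ^ 3)"
    using prod_shift_cong by (rule cong_scalar_left)
  ultimately have "[int (half_central q) * (\<Prod>i\<in>U'. i) = int (half_central (p ^ k)) * (\<Prod>i\<in>U'. i)] (mod int q ^ 3)"
    by simp
  moreover have "coprime (\<Prod>i\<in>U'. i) (int q ^ 3)"
    by (auto intro!: prod_coprime_left simp: U'_def)
  ultimately have "[int (half_central q) = int (half_central (p ^ k))] (mod int q ^ 3)"
    by (simp add: cong_mult_rcancel)
  moreover have "int q ^ 3 = int p ^ (3 * Suc k)"
    by (simp only: q_def of_nat_power power_mult[symmetric] mult.commute)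
  ultimately show ?thesis by (simp add: cong_iff_dvd_diff q_def)
qed

section \<open>Complete homogeneous sums and their generating functions\<close>

definition complete_homogeneous :: "'a set \<Rightarrow> ('a \<Rightarrow> 'r) \<Rightarrow> nat \<Rightarrow> 'r::comm_ring_1" where
  "complete_homogeneous S w k = (\<Sum>B\<in>multisets_of_size S k. \<Prod>b\<in>#B. w b)"

text \<open>
  A multiset over \<open>insert a S\<close> either contains \<open>a\<close>, and one copy can be removed, or it is a multiset
  over \<open>S\<close>.
\<close>

lemma complete_homogeneous_insert:
  assumes "finite S" "a \<notin> S"
  shows "complete_homogeneous (insert a S) w (Suc k) =
    w a * complete_homogeneous (insert a S) w k + complete_homogeneous S w (Suc k)"
proof -
  have "multisets_of_size (insert a S) (Suc k) =
      add_mset a ` multisets_of_size (insert a S) k \<union> multisets_of_size S (Suc k)" (is "?L = ?A \<union> ?B")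
  proof
    show "?L \<subseteq> ?A \<union> ?B"
    proof
      fix B assume B: "B \<in> ?L"
      show "B \<in> ?A \<union> ?B"
      proof (cases "a \<in># B")
        case True
        then obtain B' where "B = add_mset a B'" by (metis mset_add)
        then show ?thesis using B by (auto simp: multisets_of_size_def)
      qed (use B in \<open>auto simp: multisets_of_size_def\<close>)
    qed
  qed (auto simp: multisets_of_size_def)
  moreover have "?A \<inter> ?B = {}" using assms by (auto simp: multisets_of_size_def)
  ultimately have "complete_homogeneous (insert a S) w (Suc k) =
      (\<Sum>B\<in>?A. \<Prod>b\<in>#B. w b) + (\<Sum>B\<in>?B. \<Prod>b\<in>#B. w b)"
    unfolding complete_homogeneous_def
    using assms by (simp add: sum.union_disjoint finite_multisets_of_size)
  also have "(\<Sum>B\<in>?A. \<Prod>b\<in>#B. w b) = w a * complete_homogeneous (insert a S) w k"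
    unfolding complete_homogeneous_def sum_distrib_left
    by (subst sum.reindex) (auto intro: inj_onI)
  finally show ?thesis by (simp add: complete_homogeneous_def)
qed

lemma complete_homogeneous_0 [simp]: "complete_homogeneous S w 0 = 1"
  by (simp add: complete_homogeneous_def)

lemma complete_homogeneous_gf:
  fixes w :: "'a \<Rightarrow> 'r::comm_ring_1"
  assumes "finite S"
  shows "Abs_fps (complete_homogeneous S w) * (\<Prod>a\<in>S. 1 - fps_const (w a) * fps_X) = 1"
  using assms
proof (induction S rule: finite_induct)
  case empty
  have "complete_homogeneous {} w k = (if k = 0 then 1 else 0)" for k
    by (cases k) (auto simp: complete_homogeneous_def)
  then show ?case by (simp add: fps_eq_iff)
next
  case (insert a S)
  have "Abs_fps (complete_homogeneous (insert a S) w) * (1 - fps_const (w a) * fps_X) =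
      Abs_fps (complete_homogeneous S w)"
  proof (rule fps_ext)
    fix k
    have "Abs_fps (complete_homogeneous (insert a S) w) * (1 - fps_const (w a) * fps_X) =
      Abs_fps (complete_homogeneous (insert a S) w) -
      fps_const (w a) * (fps_X * Abs_fps (complete_homogeneous (insert a S) w))"
      by (simp add: algebra_simps)
    then show "fps_nth (Abs_fps (complete_homogeneous (insert a S) w) * (1 - fps_const (w a) * fps_X)) k =
        fps_nth (Abs_fps (complete_homogeneous S w)) k"
      using complete_homogeneous_insert[OF insert.hyps, of w]
      by (cases k) simp_all
  qed
  then show ?case using insert by (simp flip: mult.assoc)
qed

text \<open>
  As polynomials, both sides have degree at most \<open>d\<close>. They agree at the \<open>d\<close> roots of unity, where both
  vanish, and at 0, where both are 1.
\<close>

lemma prod_roots_of_unity: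
  assumes "d > 0"
  shows "(\<Prod>z | z ^ d = (1::complex). 1 - fps_const z * fps_X) = 1 - fps_X ^ d"
proof -
  let ?R = "{z::complex. z ^ d = 1}"
  have fin: "finite ?R" using assms by (intro finite_roots_unity) simp
  define p where "p = (\<Prod>z\<in>?R. [:1, - z:])"
  have "p = 1 - Polynomial.monom 1 d"
  proof (rule poly_eqI_degree[where A = "insert 0 ?R"])
    fix x assume x: "x \<in> insert 0 ?R"
    show "poly p x = poly (1 - Polynomial.monom 1 d) x"
    proof (cases "x = 0")
      case True
      then show ?thesis using assms by (simp add: p_def poly_prod poly_monom)
    next
      case False
      then have "x ^ d = 1" using x by simp
      then have "inverse x \<in> ?R" by (simp add: power_inverse)
      then have "poly p x = 0"
        unfolding p_def poly_prod using fin False by (intro prod_zero) (auto intro!: bexI[of _ "inverse x"])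
      then show ?thesis using \<open>x ^ d = 1\<close> by (simp add: poly_monom)
    qed
  next
    have card: "card (insert 0 ?R) = Suc d"
      using assms fin card_roots_unity_eq[of d] by (simp add: zero_power)
    have "degree p \<le> (\<Sum>z\<in>?R. degree [:1, - z:])"
      unfolding p_def by (rule degree_prod_sum_le[OF fin, unfolded o_def])
    also have "\<dots> \<le> (\<Sum>z\<in>?R. 1)" by (intro sum_mono) simp
    also have "\<dots> = d" using card_roots_unity_eq[of d] assms by simp
    finally show "degree p < card (insert 0 ?R)" using card by simp
    have "degree (1 - Polynomial.monom (1::complex) d) \<le> d"
      by (intro degree_diff_le) (auto simp: degree_monom_le)
    then show "degree (1 - Polynomial.monom (1::complex) d) < card (insert 0 ?R)" using card by simp
  qed
  then have "fps_of_poly p = 1 - fps_X ^ d"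
    by (simp add: fps_of_poly_monom)
  moreover have "fps_of_poly p = (\<Prod>z\<in>?R. 1 - fps_const z * fps_X)"
    unfolding p_def fps_of_poly_prod
    by (intro prod.cong refl) (simp add: fps_eq_iff coeff_pCons fps_mult_fps_X_commute split: nat.splits)
  ultimately show ?thesis by simp
qed

text \<open>
  The negative binomial series for the exponent \<open>-(M + 1)\<close>, with \<open>X^d\<close> substituted for the variable.
  By Pascal's rule, multiplication with \<open>1 - X^d\<close> lowers \<open>M\<close> by one.
\<close>

lemma negative_binomial_gf:
  fixes d M :: nat
  assumes "d > 0"
  shows "Abs_fps (\<lambda>i. if d dvd i then of_nat ((M + i div d) choose (i div d)) else 0) *
    (1 - fps_X ^ d) ^ Suc M = (1 :: 'r::comm_ring_1 fps)"
proof -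
  define A :: "nat \<Rightarrow> 'r fps" where
    "A = (\<lambda>M. Abs_fps (\<lambda>i. if d dvd i then of_nat ((M + i div d) choose (i div d)) else 0))"
  have nth: "fps_nth (A M * (1 - fps_X ^ d)) i = fps_nth (A M) i - (if i < d then 0 else fps_nth (A M) (i - d))" for M i
    by (simp add: right_diff_distrib fps_X_power_mult_right_nth)
  have step: "A (Suc M) * (1 - fps_X ^ d) = A M" for M
  proof (rule fps_ext)
    fix i
    show "fps_nth (A (Suc M) * (1 - fps_X ^ d)) i = fps_nth (A M) i"
    proof (cases "d dvd i")
      case True
      then obtain k where i: "i = d * k" by blast
      show ?thesis
      proof (cases k)
        case 0
        then show ?thesis using assms i unfolding nth by (simp add: A_def)
      next
        case (Suc l)
        then have "i - d = d * l" "\<not> i < d" using i by auto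
        moreover have "(Suc M + Suc l choose Suc l) = (Suc M + l choose l) + (M + Suc l choose Suc l)"
          by simp
        ultimately show ?thesis using assms Suc unfolding nth by (simp add: A_def i)
      qed
    next
      case False
      then have "\<not> i < d \<Longrightarrow> \<not> d dvd (i - d)" by (simp add: dvd_minus_self)
      then show ?thesis using False unfolding nth by (simp add: A_def)
    qed
  qed
  have base: "A 0 * (1 - fps_X ^ d) = 1"
  proof (rule fps_ext)
    fix i
    show "fps_nth (A 0 * (1 - fps_X ^ d)) i = fps_nth 1 i"
      unfolding nth using assms by (auto simp: A_def dvd_minus_self nat_dvd_not_less)
  qed
  have "A M * (1 - fps_X ^ d) ^ Suc M = 1"
  proof (induction M)
    case (Suc M)
    have "A (Suc M) * (1 - fps_X ^ d) ^ Suc (Suc M) = (A (Suc M) * (1 - fps_X ^ d)) * (1 - fps_X ^ d) ^ Suc M"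
      by (simp only: power_Suc mult.assoc)
    then show ?case using Suc by (simp only: step)
  qed (simp add: base)
  then show ?thesis by (simp add: A_def)
qed


section \<open>Counting multisets with product one by characters\<close>

text \<open>
  A finite abelian group is isomorphic to its group of characters. A symmetric nondegenerate pairing
  encodes such an isomorphism, \<open>u\<close> being sent to the character \<open>\<chi> u\<close>. It lets sums over
  characters be written as sums over group elements, and turns orders of characters into orders of
  elements.
\<close>

locale self_paired_group = comm_group G for G (structure) +
  fixes \<chi> :: "'a \<Rightarrow> 'a \<Rightarrow> complex"
  assumes fin: "finite (carrier G)"
    and pair_mult: "\<lbrakk>u \<in> carrier G; x \<in> carrier G; y \<in> carrier G\<rbrakk> \<Longrightarrow> \<chi> u (x \<otimes> y) = \<chi> u x * \<chi> u y"
    and pair_one: "u \<in> carrier G \<Longrightarrow> \<chi> u \<one> = 1"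
    and pair_sym: "\<lbrakk>u \<in> carrier G; x \<in> carrier G\<rbrakk> \<Longrightarrow> \<chi> u x = \<chi> x u"
    and pair_nondegenerate: "\<lbrakk>u \<in> carrier G; \<And>x. x \<in> carrier G \<Longrightarrow> \<chi> u x = 1\<rbrakk> \<Longrightarrow> u = \<one>"
begin

lemma order_pos: "Coset.order G > 0"
  using fin by (auto simp: Coset.order_def card_gt_0_iff)

lemma pair_pow:
  assumes "u \<in> carrier G" "x \<in> carrier G"
  shows "\<chi> u (x [^] (k::nat)) = \<chi> u x ^ k"
  by (induction k) (use assms in \<open>auto simp: pair_one pair_mult\<close>)

lemma pair_pow_left:
  assumes "u \<in> carrier G" "x \<in> carrier G"
  shows "\<chi> (u [^] (k::nat)) x = \<chi> u x ^ k"
  using assms pair_pow[of x u k] by (simp add: pair_sym[of _ x])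

lemma pair_mprod:
  assumes "u \<in> carrier G" "set_mset B \<subseteq> carrier G"
  shows "\<chi> u (mprod B) = (\<Prod>b\<in>#B. \<chi> u b)"
  using assms(2) by (induction B) (use assms(1) in \<open>auto simp: pair_one pair_mult\<close>)

lemma bij_betw_translate:
  assumes "h \<in> carrier G"
  shows "bij_betw (\<lambda>u. h \<otimes> u) (carrier G) (carrier G)"
  using assms by (intro bij_betw_byWitness[where f' = "\<lambda>u. inv h \<otimes> u"]) (auto simp: m_assoc[symmetric])

text \<open>
  Orthogonality. If \<open>x\<close> is not one, some \<open>h\<close> has \<open>\<chi> x h \<noteq> 1\<close>, and translating the summation variable
  by \<open>h\<close> multiplies the sum by that number.
\<close>

lemma sum_pair:
  assumes x: "x \<in> carrier G"
  shows "(\<Sum>u\<in>carrier G. \<chi> u x) = (if x = \<one> then of_nat (Coset.order G) else 0)"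
proof (cases "x = \<one>")
  case True
  then show ?thesis by (simp add: pair_one Coset.order_def)
next
  case False
  then obtain h where h: "h \<in> carrier G" "\<chi> x h \<noteq> 1" using pair_nondegenerate[OF x] by blast
  have "(\<Sum>u\<in>carrier G. \<chi> x u) = (\<Sum>u\<in>carrier G. \<chi> x (h \<otimes> u))"
    by (rule sum.reindex_bij_betw[OF bij_betw_translate[OF h(1)], symmetric])
  also have "\<dots> = \<chi> x h * (\<Sum>u\<in>carrier G. \<chi> x u)"
    using x h by (simp add: pair_mult sum_distrib_left)
  finally have "(\<Sum>u\<in>carrier G. \<chi> x u) = 0" using h by simp
  moreover have "(\<Sum>u\<in>carrier G. \<chi> u x) = (\<Sum>u\<in>carrier G. \<chi> x u)"
    using x by (intro sum.cong) (auto simp: pair_sym)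
  ultimately show ?thesis using False by simp
qed

text \<open>
  By orthogonality, summing \<open>\<chi> u (mprod B)\<close> over all \<open>u\<close> detects whether \<open>B\<close> has product one.
\<close>

lemma order_mult_card_product_one:
  "of_nat (Coset.order G * card (product_one_multisets k)) =
    (\<Sum>u\<in>carrier G. complete_homogeneous (carrier G) (\<chi> u) k)"
proof -
  let ?M = "multisets_of_size (carrier G) k"
  have sub: "set_mset B \<subseteq> carrier G" if "B \<in> ?M" for B
    using that by (simp add: multisets_of_size_def)
  have finM: "finite ?M" using fin by blast
  have "(\<Sum>u\<in>carrier G. complete_homogeneous (carrier G) (\<chi> u) k) =
      (\<Sum>u\<in>carrier G. \<Sum>B\<in>?M. \<chi> u (mprod B))"
    unfolding complete_homogeneous_def by (intro sum.cong refl) (simp add: pair_mprod sub)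
  also have "\<dots> = (\<Sum>B\<in>?M. \<Sum>u\<in>carrier G. \<chi> u (mprod B))" by (rule sum.swap)
  also have "\<dots> = (\<Sum>B\<in>?M. if mprod B = \<one> then of_nat (Coset.order G) else 0)"
    by (intro sum.cong refl) (simp add: sum_pair sub)
  also have "\<dots> = of_nat (Coset.order G * card (product_one_multisets k))"
    using finM by (simp add: sum.If_cases product_one_multisets_def Int_def)
  finally show ?thesis by simp
qed

text \<open>
  The values of \<open>\<chi> u\<close> form a finite set \<open>V\<close> that is closed under multiplication. Multiplication by
  \<open>v \<in> V\<close> permutes \<open>V\<close>, so comparing the products of all elements gives \<open>v ^ card V = 1\<close>. By
  nondegeneracy, \<open>u\<close> then has an order dividing \<open>card V\<close>, so \<open>V\<close> has at least as many elements
  as there are roots of unity that could occur.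
\<close>

lemma range_pair:
  assumes u: "u \<in> carrier G"
  shows "\<chi> u ` carrier G = {z. z ^ ord u = 1}"
proof -
  have d: "ord u > 0" using ord_ge_1[OF fin u] by simp
  define V where "V = \<chi> u ` carrier G"
  have finV: "finite V" using fin by (simp add: V_def)
  have finR: "finite {z::complex. z ^ ord u = 1}" using d by (intro finite_roots_unity) simp
  have sub: "V \<subseteq> {z. z ^ ord u = 1}"
    unfolding V_def using u by (auto simp: pair_one simp flip: pair_pow_left)
      (metis u pair_one pair_sym one_closed)
  have nz: "v \<noteq> 0" if "v \<in> V" for v using sub that d by (auto simp: zero_power)
  have pow: "v ^ card V = 1" if v: "v \<in> V" for v
  proof -
    have "(\<lambda>z. v * z) ` V \<subseteq> V"
      unfolding V_def using v u by (auto simp: V_def simp flip: pair_mult)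
    moreover have inj: "inj_on (\<lambda>z. v * z) V" using nz[OF v] by (auto intro: inj_onI)
    ultimately have "(\<lambda>z. v * z) ` V = V" using finV by (intro endo_inj_surj)
    then have "(\<Prod>z\<in>V. z) = (\<Prod>z\<in>V. v * z)"
      using inj by (metis (no_types, lifting) prod.reindex_cong)
    also have "\<dots> = v ^ card V * (\<Prod>z\<in>V. z)" by (simp add: prod.distrib)
    finally show ?thesis using finV nz by auto
  qed
  have "u [^] card V = \<one>"
  proof (rule pair_nondegenerate)
    show "\<chi> (u [^] card V) x = 1" if "x \<in> carrier G" for x
      using u that pow[of "\<chi> u x"] by (simp add: pair_pow_left V_def)
  qed (use u in auto)
  then have "ord u dvd card V" using u pow_eq_id by blast
  moreover have "card V > 0" using finV by (auto simp: V_def card_gt_0_iff)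
  ultimately have "ord u \<le> card V" by (rule dvd_imp_le)
  then have "card {z::complex. z ^ ord u = 1} \<le> card V" using card_roots_unity_eq[OF d] by simp
  then have "V = {z. z ^ ord u = 1}" using sub finR by (intro card_seteq) auto
  then show ?thesis by (simp add: V_def)
qed

lemma card_pair_fibre:
  assumes u: "u \<in> carrier G" and v: "v \<in> \<chi> u ` carrier G"
  shows "card {x \<in> carrier G. \<chi> u x = v} = card {x \<in> carrier G. \<chi> u x = 1}"
proof -
  obtain h where h: "h \<in> carrier G" "v = \<chi> u h" using v by blast
  have nz: "\<chi> u h * \<chi> u (inv h) = 1"
    using u h by (simp add: pair_one flip: pair_mult)
  have "bij_betw (\<lambda>x. h \<otimes> x) {x \<in> carrier G. \<chi> u x = 1} {x \<in> carrier G. \<chi> u x = v}"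
    by (rule bij_betw_byWitness[where f' = "\<lambda>x. inv h \<otimes> x"])
      (use h u nz in \<open>auto simp: pair_mult m_assoc[symmetric] mult.commute\<close>)
  then show ?thesis by (simp add: bij_betw_same_card)
qed

lemma prod_pair:
  assumes u: "u \<in> carrier G"
  shows "(\<Prod>x\<in>carrier G. 1 - fps_const (\<chi> u x) * fps_X) = (1 - fps_X ^ ord u) ^ (Coset.order G div ord u)"
    and "ord u dvd Coset.order G"
proof -
  let ?V = "\<chi> u ` carrier G" and ?c = "card {x \<in> carrier G. \<chi> u x = 1}"
  have d: "ord u > 0" using ord_ge_1[OF fin u] by simp
  have "Coset.order G = (\<Sum>v\<in>?V. card {x \<in> carrier G. \<chi> u x = v})"
    unfolding Coset.order_def card_eq_sum using fin by (intro sum.image_gen)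
  also have "\<dots> = card ?V * ?c" using u by (simp add: card_pair_fibre)
  also have "card ?V = ord u" using range_pair[OF u] card_roots_unity_eq[OF d] by simp
  finally have c: "Coset.order G = ord u * ?c" .
  then show "ord u dvd Coset.order G" by simp
  have "(\<Prod>x\<in>carrier G. 1 - fps_const (\<chi> u x) * fps_X) =
      (\<Prod>v\<in>?V. \<Prod>x\<in>{x \<in> carrier G. \<chi> u x = v}. 1 - fps_const (\<chi> u x) * fps_X)"
    using fin by (rule prod.image_gen)
  also have "\<dots> = (\<Prod>v\<in>?V. (1 - fps_const v * fps_X) ^ ?c)"
  proof (intro prod.cong refl)
    fix v assume "v \<in> ?V"
    then have "(1 - fps_const v * fps_X) ^ ?c = (\<Prod>x\<in>{x \<in> carrier G. \<chi> u x = v}. 1 - fps_const v * fps_X)"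
      using card_pair_fibre[OF u] by (simp only: prod_constant)
    also have "\<dots> = (\<Prod>x\<in>{x \<in> carrier G. \<chi> u x = v}. 1 - fps_const (\<chi> u x) * fps_X)"
      by (intro prod.cong) auto
    finally show "(\<Prod>x\<in>{x \<in> carrier G. \<chi> u x = v}. 1 - fps_const (\<chi> u x) * fps_X) =
      (1 - fps_const v * fps_X) ^ ?c" by simp
  qed
  also have "\<dots> = (1 - fps_X ^ ord u) ^ ?c"
    by (simp add: prod_power_distrib[symmetric] range_pair[OF u] prod_roots_of_unity[OF d])
  also have "?c = Coset.order G div ord u" using c d by (metis nonzero_mult_div_cancel_left less_irrefl)
  finally show "(\<Prod>x\<in>carrier G. 1 - fps_const (\<chi> u x) * fps_X) =
    (1 - fps_X ^ ord u) ^ (Coset.order G div ord u)" .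
qed

text \<open>
  The generating functions \<open>complete_homogeneous_gf\<close> and \<open>negative_binomial_gf\<close> are both inverse to
  the product in \<open>prod_pair\<close>, hence equal.
\<close>

lemma complete_homogeneous_pair:
  assumes u: "u \<in> carrier G"
  defines "N \<equiv> Coset.order G div ord u"
  shows "complete_homogeneous (carrier G) (\<chi> u) (Coset.order G) = of_nat (half_central N)"
proof -
  have d: "ord u > 0" using ord_ge_1[OF fin u] by simp
  have n: "Coset.order G = ord u * N" using prod_pair(2)[OF u] by (simp add: N_def)
  then have "N > 0" using order_pos by (cases N) auto
  then obtain M where M: "N = Suc M" by (cases N) auto
  let ?H = "Abs_fps (complete_homogeneous (carrier G) (\<chi> u))"
  let ?A = "Abs_fps (\<lambda>i. if ord u dvd i then of_nat ((M + i div ord u) choose (i div ord u)) else 0) :: complex fps"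
  let ?P = "(1 - fps_X ^ ord u) ^ N :: complex fps"
  have "?H * ?P = 1"
    using complete_homogeneous_gf[OF fin, of "\<chi> u"] by (simp add: prod_pair(1)[OF u] N_def)
  moreover have "?A * ?P = 1" using negative_binomial_gf[OF d, of M] unfolding M .
  moreover have "?H * (?A * ?P) = ?A * (?H * ?P)" by (rule mult.left_commute)
  ultimately have "?H = ?A" by (simp only: mult_1_right)
  then have "fps_nth ?H (Coset.order G) = fps_nth ?A (Coset.order G)" by simp
  then show ?thesis using d by (simp add: n M half_central_def mult_2)
qed

theorem order_mult_card_product_one_multisets:
  "Coset.order G * card (product_one_multisets (Coset.order G)) =
    (\<Sum>u\<in>carrier G. half_central (Coset.order G div ord u))"
proof -
  have "(of_nat (Coset.order G * card (product_one_multisets (Coset.order G))) :: complex) =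
    of_nat (\<Sum>u\<in>carrier G. half_central (Coset.order G div ord u))"
    unfolding order_mult_card_product_one of_nat_sum by (intro sum.cong refl complete_homogeneous_pair)
  then show ?thesis by (simp only: of_nat_eq_iff)
qed

end

section \<open>Products of cyclic groups\<close>

lemma cis_mod_cong:
  fixes a b :: int and m :: nat
  assumes "m > 0" "[a = b] (mod int m)"
  shows "cis (2 * pi * of_int a / of_nat m) = cis (2 * pi * of_int b / of_nat m)"
proof -
  obtain c where c: "a = b + int m * c"
    using assms(2) by (metis cong_iff_lin cong_sym mult.commute)
  have "cis (2 * pi * of_int a / of_nat m) =
      cis (2 * pi * of_int b / of_nat m) * cis (2 * pi * of_int c)"
    unfolding cis_mult c using assms(1) by (simp add: field_simps)
  then show ?thesis by (simp add: cis_multiple_2pi)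
qed

lemma cis_eq_1_imp_dvd:
  fixes a :: int and m :: nat
  assumes "m > 0" "cis (2 * pi * of_int a / of_nat m) = 1"
  shows "int m dvd a"
proof -
  have "cos (2 * pi * of_int a / of_nat m) = 1" using assms(2) by (simp add: complex_eq_iff)
  then obtain c :: int where "2 * pi * of_int a / of_nat m = of_int c * 2 * pi"
    by (auto simp: cos_one_2pi_int)
  then have "real_of_int a = of_int (int m * c)" using assms(1) by (simp add: field_simps)
  then have "a = int m * c" by (simp only: of_int_eq_iff)
  then show ?thesis by simp
qed

text \<open>
  The product of the standard pairings \<open>(a, b) \<mapsto> exp (2 \<pi> \<i> a b / m)\<close> of the groups \<open>\<int>/m\<close>.
\<close>

definition cyclic_product_pairing :: "'i set \<Rightarrow> ('i \<Rightarrow> nat) \<Rightarrow> ('i \<Rightarrow> int) \<Rightarrow> ('i \<Rightarrow> int) \<Rightarrow> complex" where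
  "cyclic_product_pairing I m u x = (\<Prod>i\<in>I. cis (2 * pi * of_int (u i * x i) / of_nat (m i)))"

theorem self_paired_cyclic_product:
  assumes I: "finite I" and m: "\<And>i. i \<in> I \<Longrightarrow> m i > 0"
  shows "self_paired_group (product_group I (\<lambda>i. integer_mod_group (m i))) (cyclic_product_pairing I m)"
    (is "self_paired_group ?G ?\<chi>")
proof -
  have car: "carrier ?G = (\<Pi>\<^sub>E i\<in>I. {0..<int (m i)})"
    unfolding carrier_product_group using m by (intro PiE_cong) (auto simp: carrier_integer_mod_group)
  interpret group ?G by simp
  have "comm_group ?G"
    by (rule group_comm_groupI) (simp add: add.commute)
  then interpret comm_group ?G .
  show ?thesis
  proof
    show "finite (carrier ?G)" unfolding car using I by (intro finite_PiE) auto
    show "?\<chi> u (x \<otimes>\<^bsub>?G\<^esub> y) = ?\<chi> u x * ?\<chi> u y" for u x y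
      unfolding cyclic_product_pairing_def prod.distrib[symmetric]
    proof (intro prod.cong refl)
      fix i assume i: "i \<in> I"
      have "cis (2 * pi * of_int (u i * ((x i + y i) mod int (m i))) / of_nat (m i)) =
          cis (2 * pi * of_int (u i * (x i + y i)) / of_nat (m i))"
        by (rule cis_mod_cong) (use m[OF i] in \<open>auto simp: cong_def mod_mult_right_eq\<close>)
      then show "cis (2 * pi * of_int (u i * (x \<otimes>\<^bsub>?G\<^esub> y) i) / of_nat (m i)) =
          cis (2 * pi * of_int (u i * x i) / of_nat (m i)) * cis (2 * pi * of_int (u i * y i) / of_nat (m i))"
        using i by (simp add: cis_mult ring_distribs add_divide_distrib)
    qed
    show "?\<chi> u \<one>\<^bsub>?G\<^esub> = 1" for u by (simp add: cyclic_product_pairing_def)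
    show "?\<chi> u x = ?\<chi> x u" for u x by (simp add: cyclic_product_pairing_def mult.commute)
    show "u = \<one>\<^bsub>?G\<^esub>" if u: "u \<in> carrier ?G" and triv: "\<And>x. x \<in> carrier ?G \<Longrightarrow> ?\<chi> u x = 1" for u
    proof -
      have "u j = 0" if j: "j \<in> I" for j
      proof -
        have uj: "0 \<le> u j" "u j < int (m j)" using u j unfolding car by (auto simp: PiE_iff)
        have "int (m j) dvd u j"
        proof (cases "m j = 1")
          case False
          \<comment> \<open>Pairing \<open>u\<close> with the \<open>j\<close>-th unit vector reads off \<open>u j\<close> modulo \<open>m j\<close>. In the trivial group
            \<open>m j = 1\<close> there is no such vector.\<close>
          define x where "x = (\<lambda>i\<in>I. if i = j then 1 else 0 :: int)"
          have "x \<in> carrier ?G"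
            unfolding car using m[OF j] False m by (auto simp: x_def)
          then have "?\<chi> u x = 1" by (rule triv)
          moreover have "?\<chi> u x = (\<Prod>i\<in>I. if i = j then cis (2 * pi * of_int (u i) / of_nat (m i)) else 1)"
            unfolding cyclic_product_pairing_def by (intro prod.cong refl) (auto simp: x_def)
          ultimately have "cis (2 * pi * of_int (u j) / of_nat (m j)) = 1"
            using I j by (simp add: prod.delta)
          then show ?thesis using cis_eq_1_imp_dvd m[OF j] by blast
        qed simp
        then show ?thesis using uj zdvd_not_zless[of "u j" "int (m j)"] by force
      qed
      then show ?thesis using u by (auto simp: PiE_iff extensional_def fun_eq_iff)
    qed
  qed
qed

lemma nat_pow_cyclic_product:
  "u [^]\<^bsub>product_group I (\<lambda>i. integer_mod_group (m i))\<^esub> (k::nat) =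
    (\<lambda>i\<in>I. (int k * u i) mod int (m i))"
  by (induction k) (auto simp: fun_eq_iff algebra_simps mod_simps)

lemma card_prime_power_torsion:
  fixes p :: nat
  assumes "p > 0"
  shows "card {x\<in>{0..<int (p ^ k)}. (int (p ^ j) * x) mod int (p ^ k) = 0} = p ^ min j k"
proof (cases "k \<le> j")
  case True
  then have "int (p ^ k) dvd int (p ^ j) * x" for x by (simp add: le_imp_power_dvd)
  then have "{x\<in>{0..<int (p ^ k)}. (int (p ^ j) * x) mod int (p ^ k) = 0} = {0..<int (p ^ k)}"
    by (auto simp: mod_eq_0_iff_dvd)
  then show ?thesis using True by (simp add: min_absorb2 nat_power_eq)
next
  case False
  define d where "d = k - j"
  have k: "k = j + d" using False by (simp add: d_def)
  have p0: "int p ^ j > 0" "int p ^ d > 0" using assms by simp_all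
  have "{x\<in>{0..<int (p ^ k)}. (int (p ^ j) * x) mod int (p ^ k) = 0} = (\<lambda>y. int p ^ d * y) ` {0..<int (p ^ j)}"
    (is "?L = ?R")
  proof
    show "?L \<subseteq> ?R"
    proof
      fix x assume x: "x \<in> ?L"
      then have "int p ^ j * int p ^ d dvd int p ^ j * x" by (simp add: mod_eq_0_iff_dvd k power_add)
      then obtain y where y: "x = int p ^ d * y" using p0 by auto
      then have "0 \<le> int p ^ d * y" "int p ^ d * y < int p ^ d * int p ^ j"
        using x by (auto simp: k power_add mult.commute)
      then have "0 \<le> y" "y < int p ^ j" using p0 by (auto simp: zero_le_mult_iff)
      then show "x \<in> ?R" using y by auto
    qed
    show "?R \<subseteq> ?L"
      using p0 by (auto simp: k power_add mod_eq_0_iff_dvd mult.commute)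
  qed
  moreover have "inj_on (\<lambda>y. int p ^ d * y) {0..<int (p ^ j)}" using p0 by (auto intro: inj_onI)
  ultimately show ?thesis using False by (simp add: card_image min_absorb1 nat_power_eq)
qed

lemma abelian_p_group_carrier:
  assumes "p > 0"
  shows "carrier (abelian_p_group p ks) = (\<Pi>\<^sub>E i\<in>{..<length ks}. {0..<int (p ^ (ks ! i))})"
  unfolding abelian_p_group_def carrier_product_group using assms
  by (intro PiE_cong) (auto simp: carrier_integer_mod_group)

lemma card_abelian_p_group_torsion:
  assumes "p > 0"
  shows "card {u \<in> carrier (abelian_p_group p ks). u [^]\<^bsub>abelian_p_group p ks\<^esub> (p ^ j) = \<one>\<^bsub>abelian_p_group p ks\<^esub>} =
    p ^ (\<Sum>i<length ks. min j (ks ! i))"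
proof -
  let ?I = "{..<length ks}"
  let ?T = "\<lambda>i. {x\<in>{0..<int (p ^ (ks ! i))}. (int (p ^ j) * x) mod int (p ^ (ks ! i)) = 0}"
  have one: "\<one>\<^bsub>abelian_p_group p ks\<^esub> = (\<lambda>i\<in>?I. 0)" by (simp add: abelian_p_group_def)
  have pow: "u [^]\<^bsub>abelian_p_group p ks\<^esub> (p ^ j) = (\<lambda>i\<in>?I. (int (p ^ j) * u i) mod int (p ^ (ks ! i)))" for u
    unfolding abelian_p_group_def nat_pow_cyclic_product using assms by simp
  have "{u \<in> carrier (abelian_p_group p ks). u [^]\<^bsub>abelian_p_group p ks\<^esub> (p ^ j) = \<one>\<^bsub>abelian_p_group p ks\<^esub>} = PiE ?I ?T"
  proof -
    have eq: "(\<lambda>i\<in>?I. f i) = (\<lambda>i\<in>?I. 0) \<longleftrightarrow> (\<forall>i\<in>?I. f i = 0)" for f :: "nat \<Rightarrow> int"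
    proof
      assume e: "(\<lambda>i\<in>?I. f i) = (\<lambda>i\<in>?I. 0)"
      show "\<forall>i\<in>?I. f i = 0"
      proof
        fix i assume "i \<in> ?I"
        then show "f i = 0" using fun_cong[OF e, of i] by simp
      qed
    qed (intro restrict_ext, simp)
    show ?thesis
      unfolding abelian_p_group_carrier[OF assms] one pow eq 
      by (rule Set.set_eqI) (simp only: PiE_iff mem_Collect_eq, blast)
  qed
  also have "card \<dots> = (\<Prod>i\<in>?I. card (?T i))" by (rule card_PiE) simp
  also have "\<dots> = p ^ (\<Sum>i<length ks. min j (ks ! i))"
    by (simp only: card_prime_power_torsion[OF assms] power_sum)
  finally show ?thesis .
qed

lemma order_abelian_p_group:
  assumes "p > 0"
  shows "Coset.order (abelian_p_group p ks) = p ^ sum_list ks"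
proof -
  have "Coset.order (abelian_p_group p ks) = (\<Prod>i<length ks. p ^ (ks ! i))"
    unfolding Coset.order_def abelian_p_group_carrier[OF assms] by (subst card_PiE) (auto simp: nat_power_eq)
  also have "\<dots> = p ^ sum_list ks"
    by (simp add: power_sum sum_list_sum_nth atLeast0LessThan)
  finally show ?thesis .
qed

lemma cyclic_abelian_p_group_single:
  assumes "p > 1" "k > 0"
  shows "cyclic_group (abelian_p_group p [k])"
proof -
  let ?G = "abelian_p_group p [k]"
  interpret group ?G by (rule group_abelian_p_group)
  define x where "x = (\<lambda>i\<in>{..<length [k]}. 1 :: int)"
  have p0: "p > 0" and pk: "int p ^ k > 1" using assms by (auto simp: one_less_power)
  have x: "x \<in> carrier ?G"
    unfolding abelian_p_group_carrier[OF p0] using pk by (auto simp: x_def)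
  have "carrier ?G = range (\<lambda>n::int. x [^]\<^bsub>?G\<^esub> n)"
  proof
    show "carrier ?G \<subseteq> range (\<lambda>n::int. x [^]\<^bsub>?G\<^esub> n)"
    proof
      fix u assume u: "u \<in> carrier ?G"
      have u0: "0 \<le> u 0" "u 0 < int p ^ k" "u \<in> extensional {..<1}"
        using u unfolding abelian_p_group_carrier[OF p0] by (auto simp: PiE_iff)
      have "x [^]\<^bsub>?G\<^esub> nat (u 0) = u"
        unfolding abelian_p_group_def nat_pow_cyclic_product
        using u0 by (auto simp: fun_eq_iff x_def extensional_def)
      then show "u \<in> range (\<lambda>n::int. x [^]\<^bsub>?G\<^esub> n)" by (metis int_pow_int rangeI)
    qed
  qed (use x in auto)
  then show ?thesis unfolding cyclic_group using x by blast
qed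

text \<open>
  A part that equals the whole sum would leave no room for another positive part, and the group
  would have a single cyclic factor.
\<close>

lemma less_sum_list_if_not_cyclic:
  assumes p: "p > 1" and pos: "\<forall>k\<in>set ks. k \<ge> 1" and nc: "\<not> cyclic_group (abelian_p_group p ks)"
    and i: "i < length ks"
  shows "ks ! i < sum_list ks"
proof -
  have ks: "ks = take i ks @ ks ! i # drop (Suc i) ks" using i by (rule id_take_nth_drop)
  have "take i ks \<noteq> [] \<or> drop (Suc i) ks \<noteq> []"
  proof (rule ccontr)
    assume "\<not> ?thesis"
    then have "ks = [ks ! i]" using ks by (metis append_Nil)
    moreover have "ks ! i > 0" using pos i by (simp add: Suc_le_eq)
    ultimately show False using cyclic_abelian_p_group_single[OF p] nc by metis
  qed
  moreover have "sum_list l > 0" if "l \<noteq> []" "set l \<subseteq> set ks" for l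
    using that pos by (cases l) (auto simp: Suc_le_eq)
  ultimately have "sum_list (take i ks) + sum_list (drop (Suc i) ks) > 0"
    by (metis add_gr_0 set_drop_subset set_take_subset)
  moreover have "sum_list ks = sum_list (take i ks) + ks ! i + sum_list (drop (Suc i) ks)"
    by (subst ks) simp
  ultimately show ?thesis by simp
qed

lemma min_sum_list_le: "min j (sum_list ks) \<le> (\<Sum>k\<leftarrow>ks. min j k)" for j :: nat
  by (induction ks) auto

section \<open>The congruence\<close>

text \<open>
  Here \<open>torsion\<close> bounds the numbers \<open>A\<^sub>j\<close> of the summation by parts in general, and \<open>exponent\<close>
  determines the last of them, \<open>A\<^bsub>m - 1\<^esub>\<close>, for which the general bound would be too weak.
\<close>

theorem (in self_paired_group) card_product_one_multisets_cong_1: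
  assumes p: "Factorial_Ring.prime p" "p \<ge> 5" and ord: "Coset.order G = p ^ m"
    and torsion: "\<And>j. j < m \<Longrightarrow> p ^ j dvd card {u \<in> carrier G. u [^] (p ^ j) = \<one>}"
    and exponent: "\<And>u. u \<in> carrier G \<Longrightarrow> u [^] (p ^ (m - 1)) = \<one>"
  shows "[card (product_one_multisets (Coset.order G)) = 1] (mod p ^ 3)"
proof -
  define N where "N = card (product_one_multisets (Coset.order G))"
  define A where "A = (\<lambda>j. card {u \<in> carrier G. u [^] (p ^ j) = \<one>})"
  define D where "D = (\<lambda>j. int (half_central (p ^ (m - j))) - int (half_central (p ^ (m - Suc j))))"
  have p1: "p > 1" using p by simp
  \<comment> \<open>Telescoping: an element of order \<open>p^i\<close> satisfies \<open>u^(p^j) = 1\<close> exactly for \<open>j \<ge> i\<close>, and the sum of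
    \<open>D j\<close> over these \<open>j < m\<close> is \<open>half_central (p^(m-i)) - half_central 1\<close>.\<close>
  have "int (half_central (p ^ m div ord u)) = 1 + (\<Sum>j<m. if u [^] (p ^ j) = \<one> then D j else 0)"
    if u: "u \<in> carrier G" for u
  proof -
    have "ord u dvd p ^ m" using prod_pair(2)[OF u] by (simp add: ord)
    then obtain i where i: "ord u = p ^ i" "i \<le> m" using p(1) divides_primepow_nat by blast
    have "u [^] (p ^ j) = \<one> \<longleftrightarrow> i \<le> j" for j
      using u p1 by (simp add: pow_eq_id i dvd_power_iff_le)
    then have "(\<Sum>j<m. if u [^] (p ^ j) = \<one> then D j else 0) = (\<Sum>j<m. if i \<le> j then D j else 0)"
      by simp
    also have "\<dots> = (\<Sum>j\<in>{i..<m}. D j)"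
      by (simp add: sum.If_cases) (intro sum.cong; auto)
    also have "\<dots> = int (half_central (p ^ (m - i))) - int (half_central (p ^ (m - m)))"
      unfolding D_def using sum_Suc_diff'[of i m "\<lambda>j. - int (half_central (p ^ (m - j)))"] i by simp
    also have "p ^ (m - i) = p ^ m div ord u"
      using i p1 by (simp add: power_diff)
    finally show ?thesis by (simp add: half_central_def)
  qed
  then have "(\<Sum>u\<in>carrier G. int (half_central (p ^ m div ord u))) =
      (\<Sum>u\<in>carrier G. 1 + (\<Sum>j<m. if u [^] (p ^ j) = \<one> then D j else 0))"
    by (intro sum.cong refl)
  also have "\<dots> = int (p ^ m) + (\<Sum>j<m. \<Sum>u\<in>carrier G. if u [^] (p ^ j) = \<one> then D j else 0)"
    using ord by (simp add: sum.distrib Coset.order_def sum.swap[of _ "carrier G"])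
  also have "(\<Sum>j<m. \<Sum>u\<in>carrier G. if u [^] (p ^ j) = \<one> then D j else 0) = (\<Sum>j<m. int (A j) * D j)"
    using fin by (intro sum.cong refl) (simp add: sum.If_cases A_def Int_def)
  finally have count: "int (p ^ m) * int N = int (p ^ m) + (\<Sum>j<m. int (A j) * D j)"
    using arg_cong[OF order_mult_card_product_one_multisets, of int] by (simp add: N_def ord)
  have "int p ^ (m + 3) dvd int (A j) * D j" if j: "j < m" for j
  proof -
    have "m - j = Suc (m - Suc j)" using j by simp
    then have D: "int p ^ (3 * (m - j)) dvd D j"
      using half_central_prime_power_cong[OF p, of "m - Suc j"] by (simp add: D_def)
    obtain a where a: "int p ^ a dvd int (A j)" "m + 3 \<le> a + 3 * (m - j)"
    proof (cases "j = m - 1")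
      case True
      have "{u \<in> carrier G. u [^] (p ^ j) = \<one>} = carrier G" using exponent True by auto
      then have "A j = p ^ m" using ord by (simp add: A_def Coset.order_def)
      then show ?thesis using that[of m] True j by simp
    next
      case False
      have "int (p ^ j) dvd int (A j)" using torsion[OF j] by (simp only: A_def of_nat_dvd_iff)
      then show ?thesis using that[of j] False j by simp
    qed
    have "int p ^ (m + 3) dvd int p ^ (a + 3 * (m - j))" using a(2) by (rule le_imp_power_dvd)
    also have "\<dots> dvd int (A j) * D j" using a(1) D by (simp add: power_add mult_dvd_mono)
    finally show ?thesis .
  qed
  then have "int p ^ (m + 3) dvd (\<Sum>j<m. int (A j) * D j)" by (intro dvd_sum) simp
  also have "(\<Sum>j<m. int (A j) * D j) = int p ^ m * (int N - 1)"
    using count by (simp add: algebra_simps)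
  finally have "int p ^ 3 dvd int N - 1"
    using p1 by (simp add: power_add)
  then have "[int N = int 1] (mod int (p ^ 3))" by (simp add: cong_iff_dvd_diff)
  then show ?thesis unfolding N_def cong_int_iff .
qed

theorem theorem1p3:
  fixes p n :: nat and ks :: "nat list"
  assumes "Factorial_Ring.prime p" and "p \<ge> 5"
    and "n > 0" and "is_partition n ks"
    and "\<not> cyclic_group (abelian_p_group p ks)"
  shows "[num_monomials (group_permanent (abelian_p_group p ks)) = 1] (mod p ^ 3)"
proof -
  let ?G = "abelian_p_group p ks"
  let ?\<chi> = "cyclic_product_pairing {..<length ks} (\<lambda>i. p ^ (ks ! i))"
  have p: "p > 0" "p > 1" using assms(2) by auto
  interpret self_paired_group ?G ?\<chi>
    unfolding abelian_p_group_def using p by (intro self_paired_cyclic_product) auto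
  have ks: "sum_list ks = n" "\<forall>k\<in>set ks. k \<ge> 1" using assms(4) by (auto simp: is_partition_def)
  have "[card (product_one_multisets (Coset.order ?G)) = 1] (mod p ^ 3)"
  proof (rule card_product_one_multisets_cong_1)
    show "Coset.order ?G = p ^ n" using order_abelian_p_group p ks by simp
    show "p ^ j dvd card {u \<in> carrier ?G. u [^]\<^bsub>?G\<^esub> (p ^ j) = \<one>\<^bsub>?G\<^esub>}" if "j < n" for j
    proof -
      have "j \<le> (\<Sum>i<length ks. min j (ks ! i))"
        using min_sum_list_le[of j ks] that ks by (simp add: sum_list_sum_nth atLeast0LessThan)
      then show ?thesis unfolding card_abelian_p_group_torsion[OF p(1)] by (rule le_imp_power_dvd)
    qed
    show "u [^]\<^bsub>?G\<^esub> (p ^ (n - 1)) = \<one>\<^bsub>?G\<^esub>" if "u \<in> carrier ?G" for u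
    proof -
      have "ks ! i \<le> n - 1" if "i < length ks" for i
        using less_sum_list_if_not_cyclic[OF p(2) ks(2) assms(5) that] ks by simp
      then have "int (p ^ (ks ! i)) dvd int (p ^ (n - 1)) * u i" if "i < length ks" for i
        using that by (simp add: le_imp_power_dvd)
      then show ?thesis
        unfolding abelian_p_group_def nat_pow_cyclic_product using p(1) by (auto simp: mod_eq_0_iff_dvd)
    qed
  qed (use assms in auto)
  then show ?thesis using num_monomials_group_permanent[OF fin] by simp
qed

end
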